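(* Let $\alpha>-1$, let $f^*\in\mathcal{C}(\mathbb{T})$, and let $f$ be an $\alpha$-harmonic function in $\mathbb{D}$ with $f=f^*$ on $\mathbb{T}$ (boundary values in the distributional sense). Then for every $z\in\mathbb{D}$, $$\|D_f(z)\|\le\begin{cases}\dfrac{2(1+\alpha)}{c_\alpha}\,\dfrac{\|f^*\|_\infty}{1-|z|^2}, & \alpha\ge 0,\\[3mm] \dfrac{2}{c_\alpha}\,\dfrac{\|f^*\|_\infty}{1-|z|^2}, & -1<\alpha<0,\end{cases}$$ where $c_\alpha=\dfrac{\Gamma\left(\frac{\alpha}{2}+1\right)^2}{\Gamma(\alpha+1)}$.
   Context: $\mathbb{D}$ is the open unit disk and $\mathbb{T}$ the unit circle in $\mathbb{C}$; functions are complex-valued; $\mathcal{C}(\mathbb{T})$ is the space of continuous functions on $\mathbb{T}$. For $\alpha>-1$ the weighted Laplace operator is $\Delta_\alpha=\partial_z(1-|z|^2)^{-\alpha}\overline{\partial}_z$, i.e. $\Delta_\alpha f=\partial_z\big((1-|z|^2)^{-\alpha}\,\overline{\partial}_z f\big)$, where $\partial_z=\frac12(\partial_x-i\partial_y)$ and $\overline{\partial}_z=\frac12(\partial_x+i\partial_y)$. A function $f\in\mathcal{C}^2(\mathbb{D})$ is $\alpha$-harmonic if $\Delta_\alpha f=0$ in $\mathbb{D}$. The boundary condition $f=f^*$ on $\mathbb{T}$ means that $f(re^{i\theta})\to f^*(e^{i\theta})$ in the space of distributions $\mathcal{D}'(\mathbb{T})$ as $r\to1^-$. $\|f^*\|_\infty=\operatorname{ess\,sup}_{z\in\mathbb{T}}|f^*(z)|$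 and $\|D_f(z)\|=|f_z(z)|+|f_{\bar z}(z)|$, where $f_z=\partial_z f$, $f_{\bar z}=\overline{\partial}_z f$. $\Gamma$ is the Gamma function. *)

theory Defs
  imports "HOL-Analysis.Analysis" "HOL-Probability.Essential_Supremum"
begin

text \<open>
  Functions of a complex variable are total functions of type \<^typ>\<open>complex \<Rightarrow> complex\<close>; the
  open unit disk is \<^term>\<open>ball (0::complex) 1\<close> and the unit circle is \<^term>\<open>sphere (0::complex) 1\<close>.
  The real partial derivatives are the values of the real Frechet derivative at the basis vectors
  \<^term>\<open>1::complex\<close> and \<^term>\<open>\<i>\<close>.
\<close>

definition partial_x :: "(complex \<Rightarrow> complex) \<Rightarrow> complex \<Rightarrow> complex" where
  "partial_x f z = frechet_derivative f (at z) 1"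

definition partial_y :: "(complex \<Rightarrow> complex) \<Rightarrow> complex \<Rightarrow> complex" where
  "partial_y f z = frechet_derivative f (at z) \<i>"

definition C1_on :: "complex set \<Rightarrow> (complex \<Rightarrow> complex) \<Rightarrow> bool" where
  "C1_on S f \<longleftrightarrow> (\<forall>z\<in>S. f differentiable (at z)) \<and>
     continuous_on S (partial_x f) \<and> continuous_on S (partial_y f)"

definition C2_on :: "complex set \<Rightarrow> (complex \<Rightarrow> complex) \<Rightarrow> bool" where
  "C2_on S f \<longleftrightarrow> C1_on S f \<and> C1_on S (partial_x f) \<and> C1_on S (partial_y f)"

definition d_z :: "(complex \<Rightarrow> complex) \<Rightarrow> complex \<Rightarrow> complex" where
  "d_z f z = (partial_x f z - \<i> * partial_y f z) / 2"

definition d_zbar :: "(complex \<Rightarrow> complex) \<Rightarrow> complex \<Rightarrow> complex" where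
  "d_zbar f z = (partial_x f z + \<i> * partial_y f z) / 2"

definition weighted_laplacian :: "real \<Rightarrow> (complex \<Rightarrow> complex) \<Rightarrow> complex \<Rightarrow> complex" where
  "weighted_laplacian \<alpha> f =
     d_z (\<lambda>w. of_real ((1 - (cmod w)\<^sup>2) powr (- \<alpha>)) * d_zbar f w)"

definition alpha_harmonic :: "real \<Rightarrow> (complex \<Rightarrow> complex) \<Rightarrow> bool" where
  "alpha_harmonic \<alpha> f \<longleftrightarrow>
     C2_on (ball 0 1) f \<and> (\<forall>z\<in>ball 0 1. weighted_laplacian \<alpha> f z = 0)"

text \<open>
  Test functions on the circle: only the values on the circle matter, and smoothness means that
  all derivatives with respect to the angle exist. Here \<open>D n\<close> is the \<open>n\<close>-th derivative.
\<close>

definition smooth_on_circle :: "(complex \<Rightarrow> complex) \<Rightarrow> bool" where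
  "smooth_on_circle \<phi> \<longleftrightarrow>
     (\<exists>D :: nat \<Rightarrow> real \<Rightarrow> complex. D 0 = (\<lambda>t. \<phi> (cis t)) \<and>
        (\<forall>n t. (D n has_vector_derivative D (Suc n) t) (at t)))"

text \<open>
  Convergence of \<open>f (r e\<^sup>i\<^sup>t)\<close> to \<open>g (e\<^sup>i\<^sup>t)\<close> as distributions on the circle, when \<open>r\<close> tends to
  \<open>1\<close> from the left, i.e. tested against every smooth function. It is used only for \<open>f\<close>
  continuous on the disk and \<open>g\<close> continuous on the circle, so that all integrals exist.
\<close>

definition distributional_boundary_value ::
    "(complex \<Rightarrow> complex) \<Rightarrow> (complex \<Rightarrow> complex) \<Rightarrow> bool" where
  "distributional_boundary_value f g \<longleftrightarrow>
     (\<forall>\<phi>. smooth_on_circle \<phi> \<longrightarrow>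
        ((\<lambda>r. integral {0..2*pi} (\<lambda>t. f (of_real r * cis t) * \<phi> (cis t)))
           \<longlongrightarrow> integral {0..2*pi} (\<lambda>t. g (cis t) * \<phi> (cis t))) (at_left 1))"

text \<open>
  The essential supremum is taken in the extended reals; it is finite for the functions
  continuous on the circle considered here, so the conversion to \<^typ>\<open>real\<close> loses nothing.
\<close>

definition circle_sup_norm :: "(complex \<Rightarrow> complex) \<Rightarrow> real" where
  "circle_sup_norm g =
     real_of_ereal (esssup (lebesgue_on {0..2*pi}) (\<lambda>t. ereal (cmod (g (cis t)))))"

definition D_norm :: "(complex \<Rightarrow> complex) \<Rightarrow> complex \<Rightarrow> real" where
  "D_norm f z = cmod (d_z f z) + cmod (d_zbar f z)"

definition c_const :: "real \<Rightarrow> real" where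
  "c_const \<alpha> = (Gamma (\<alpha> / 2 + 1))\<^sup>2 / Gamma (\<alpha> + 1)"

end

theory Submission
  imports Defs "HOL-Complex_Analysis.Complex_Analysis"
begin

text \<open>
  The equation says that \<open>(1 - |z|\<^sup>2) powr (- \<alpha>)\<close> times the \<open>z\<close>-bar derivative of \<open>f\<close> is the
  conjugate of a holomorphic function \<open>H\<close>. Integrating along radii gives a particular solution, so
  \<open>f\<close> is a holomorphic function plus an explicit potential of \<open>H\<close>; testing against \<open>cis (k t)\<close> on
  circles of radius \<open>r\<close> tending to \<open>1\<close> identifies both Taylor series with the Fourier coefficients
  of the boundary function. Summing the series represents \<open>f\<close> as a Poisson type integral whose
  kernel \<open>K\<close> satisfies \<open>|K_z| + |K_zbar| \<le> C |K| / (1 - |z|\<^sup>2)\<close> with \<open>C = 2(1 + \<alpha>)\<close> or \<open>C = 2\<close>.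
  By Parseval's identity the mean of \<open>|K|\<close> is \<open>(1 - x) powr (\<alpha> + 1)\<close> times a power series in
  \<open>x = |z|\<^sup>2\<close>, which is bounded coefficientwise by \<open>(1 - x) powr (- \<alpha> - 1)\<close> divided by \<open>c_const \<alpha>\<close>.
\<close>

subsection \<open>Wirtinger derivatives and integrals depending on a parameter\<close>

text \<open>Distributional boundary values give no pointwise control near the circle: only single
  Fourier coefficients can be carried to the boundary. On the circle of radius \<open>r\<close> the
  holomorphic part has the frequencies \<open>n \<ge> 0\<close> and the potential the frequencies
  \<open>-(m + 1)\<close>, so the two do not interfere, and each coefficient is explicit in
  \<open>r\<close>. The potential contributes an incomplete beta integral, whose limit
  \<open>Beta (m + 1) (\<alpha> + 1)\<close> comes from an integral that converges exactly for
  \<open>\<alpha> > -1\<close>. Dividing by this limit produces the weights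
  \<open>(\<alpha> + 1) * pochhammer (\<alpha> + 2) m / fact m\<close>. They are the Taylor
  coefficients of an explicit power of \<open>1 - w\<close>, so the negative frequencies of the
  kernel form a potential again, and that one integrates in closed form. The factor \<open>C\<close>
  is \<open>(1 + \<bar>\<alpha>\<bar>) + (1 + \<alpha>)\<close>, one summand for each Wirtinger
  derivative of the kernel; the case split on the sign of \<alpha> is the absolute value.\<close>

lemma linear_complex_wirtinger:
  fixes L :: "complex \<Rightarrow> complex"
  assumes "linear L"
  shows "L v = (L 1 - \<i> * L \<i>) / 2 * v + (L 1 + \<i> * L \<i>) / 2 * cnj v"
proof -
  have "v = Re v *\<^sub>R 1 + Im v *\<^sub>R \<i>"
    by (simp add: complex_eq_iff)
  then have "L v = Re v *\<^sub>R L 1 + Im v *\<^sub>R L \<i>"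
    using linear_add[OF assms] linear_scale[OF assms] by metis
  then show ?thesis
    by (simp add: complex_eq_iff field_simps)
qed

lemma has_derivative_wirtinger:
  assumes "f differentiable (at z)"
  shows "(f has_derivative (\<lambda>v. d_z f z * v + d_zbar f z * cnj v)) (at z)"
proof -
  have D: "(f has_derivative frechet_derivative f (at z)) (at z)"
    using assms frechet_derivative_works by blast
  then have "linear (frechet_derivative f (at z))"
    by (rule has_derivative_linear)
  then have "frechet_derivative f (at z) = (\<lambda>v. d_z f z * v + d_zbar f z * cnj v)"
    unfolding d_z_def d_zbar_def partial_x_def partial_y_def
    using linear_complex_wirtinger by blast
  with D show ?thesis
    by simp
qed

lemma wirtinger_unique:
  assumes "(f has_derivative (\<lambda>v. a * v + b * cnj v)) (at z)"
  shows "d_z f z = a" "d_zbar f z = b"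
proof -
  have "frechet_derivative f (at z) = (\<lambda>v. a * v + b * cnj v)"
    using frechet_derivative_at[OF assms] by simp
  then show "d_z f z = a" "d_zbar f z = b"
    by (auto simp: d_z_def d_zbar_def partial_x_def partial_y_def complex_eq_iff field_simps)
qed

text \<open>Serves both the potential and the Poisson integral. The coefficients \<open>A\<close>
  and \<open>B\<close> are packed into one bounded linear map \<open>D z t\<close>, whose continuity
  in \<open>(z, t)\<close> can be tested on basis vectors because the space is finite
  dimensional.\<close>

lemma leibniz_rule_wirtinger:
  fixes k :: "complex \<Rightarrow> real \<Rightarrow> complex"
  assumes U: "open U" "convex U" "z0 \<in> U"
    and deriv: "\<And>z t. z \<in> U \<Longrightarrow> t \<in> {a..b} \<Longrightarrow>
      ((\<lambda>z. k z t) has_derivative (\<lambda>v. A z t * v + B z t * cnj v)) (at z)"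
    and int: "\<And>z. z \<in> U \<Longrightarrow> k z integrable_on {a..b}"
    and A: "continuous_on (U \<times> {a..b}) (\<lambda>(z, t). A z t)"
    and B: "continuous_on (U \<times> {a..b}) (\<lambda>(z, t). B z t)"
  shows "((\<lambda>z. integral {a..b} (k z)) has_derivative
      (\<lambda>v. integral {a..b} (A z0) * v + integral {a..b} (B z0) * cnj v)) (at z0)"
proof -
  define D where "D z t = Blinfun (\<lambda>v. A z t * v + B z t * cnj v)" for z t
  have bl: "bounded_linear (\<lambda>v. A z t * v + B z t * cnj v)" for z t
    by (intro bounded_linear_add bounded_linear_mult_right
        bounded_linear_compose[OF bounded_linear_mult_right bounded_linear_cnj])
  have D_apply: "blinfun_apply (D z t) v = A z t * v + B z t * cnj v" for z t v
    unfolding D_def using bounded_linear_Blinfun_apply[OF bl] by metis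
  have contD: "continuous_on (U \<times> {a..b}) (\<lambda>(z, t). D z t)"
    unfolding case_prod_unfold
    by (rule continuous_on_blinfun_componentwise)
      (use A B in \<open>auto simp: D_apply case_prod_unfold intro!: continuous_intros\<close>)
  have slice: "continuous_on {a..b} (\<lambda>t. h z0 t)"
    if "continuous_on (U \<times> {a..b}) (\<lambda>(z, t). h z t)" for h :: "complex \<Rightarrow> real \<Rightarrow> 'x::topological_space"
    using continuous_on_compose2[OF that continuous_on_Pair[OF continuous_on_const[of "{a..b}" z0] continuous_on_id]] U(3)
    by (simp add: image_subset_iff)
  have "((\<lambda>z. integral (cbox a b) (k z)) has_derivative integral (cbox a b) (D z0)) (at z0 within U)"
  proof (rule leibniz_rule)
    show "((\<lambda>z. k z t) has_derivative blinfun_apply (D z t)) (at z within U)"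
      if "z \<in> U" "t \<in> cbox a b" for z t
    proof -
      have "blinfun_apply (D z t) = (\<lambda>v. A z t * v + B z t * cnj v)"
        by (simp add: D_apply fun_eq_iff)
      then show ?thesis
        using deriv[of z t] that by (simp add: has_derivative_at_withinI)
    qed
    show "k z integrable_on cbox a b" if "z \<in> U" for z
      using int[OF that] by (simp only: cbox_interval)
    show "continuous_on (U \<times> cbox a b) (\<lambda>(z, t). D z t)"
      using contD by (simp only: cbox_interval)
  qed (fact U)+
  then have *: "((\<lambda>z. integral {a..b} (k z)) has_derivative integral {a..b} (D z0)) (at z0)"
    by (simp only: cbox_interval at_within_open[OF U(3) U(1)])
  have "D z0 integrable_on {a..b}"
    by (intro integrable_continuous_real slice contD)
  then have "blinfun_apply (integral {a..b} (D z0)) v =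
      integral {a..b} (A z0) * v + integral {a..b} (B z0) * cnj v" for v
    using integrable_continuous_real[OF slice[OF A]] integrable_continuous_real[OF slice[OF B]]
    by (simp add: blinfun_apply_integral D_apply integral_add integrable_on_mult_left)
  then have "blinfun_apply (integral {a..b} (D z0)) =
      (\<lambda>v. integral {a..b} (A z0) * v + integral {a..b} (B z0) * cnj v)"
    by blast
  with * show ?thesis
    by simp
qed

section \<open>Termwise integration and orthogonality of the exponentials\<close>

lemma sums_integral_weierstrass:
  fixes g :: "nat \<Rightarrow> real \<Rightarrow> complex"
  assumes cont: "\<And>n. continuous_on {a..b} (g n)"
    and bound: "\<And>n t. t \<in> {a..b} \<Longrightarrow> norm (g n t) \<le> M n"
    and M: "summable M"
    and G: "\<And>t. t \<in> {a..b} \<Longrightarrow> (\<lambda>n. g n t) sums G t"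
  shows "(\<lambda>n. integral {a..b} (g n)) sums integral {a..b} G" "continuous_on {a..b} G"
proof -
  have "uniform_limit {a..b} (\<lambda>n t. \<Sum>i<n. g i t) (\<lambda>t. \<Sum>i. g i t) sequentially"
    by (rule Weierstrass_m_test[OF bound M])
  then have ul: "uniform_limit {a..b} (\<lambda>n t. \<Sum>i<n. g i t) G sequentially"
    by (rule uniform_limit_cong'[THEN iffD1, rotated -1]) (use G in \<open>auto simp: sums_iff\<close>)
  have c: "continuous_on {a..b} (\<lambda>t. \<Sum>i<n. g i t)" for n
    by (intro continuous_on_sum cont)
  show "continuous_on {a..b} G"
    by (rule uniform_limit_theorem[OF _ ul]) (auto simp: c)
  obtain I J where I: "\<And>n. ((\<lambda>t. \<Sum>i<n. g i t) has_integral I n) {a..b}"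
      "(G has_integral J) {a..b}" "I \<longlonglongrightarrow> J"
    using uniform_limit_integral[OF ul c] by auto
  have "I n = (\<Sum>i<n. integral {a..b} (g i))" for n
    using I(1)[of n] integral_sum[of "{..<n}" g "{a..b}"] cont
    by (auto simp: integrable_continuous_real dest!: integral_unique)
  then have "I = (\<lambda>n. \<Sum>i<n. integral {a..b} (g i))"
    by auto
  with I(2,3) show "(\<lambda>n. integral {a..b} (g n)) sums integral {a..b} G"
    by (auto simp: sums_def integral_unique)
qed

lemma integral_cis_int:
  "integral {0..2*pi} (\<lambda>t. cis (of_int k * t)) = (if k = 0 then 2 * pi else 0)"
proof (cases "k = 0")
  case False
  define c where "c = \<i> * of_int k"
  have c: "c \<noteq> 0" and cis: "cis (of_int k * t) = exp (c * of_real t)" for t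
    using False by (simp_all add: c_def cis_conv_exp mult.assoc)
  have "((\<lambda>t. exp (c * of_real t) / c) has_vector_derivative exp (c * of_real t)) (at t within {0..2*pi})" for t
    by (rule has_vector_derivative_real_field) (use c in \<open>auto intro!: derivative_eq_intros\<close>)
  then have "((\<lambda>t. cis (of_int k * t)) has_integral
      cis (of_int k * (2*pi)) / c - cis (of_int k * 0) / c) {0..2*pi}"
    unfolding cis by (intro fundamental_theorem_of_calculus) auto
  moreover have "cis (of_int k * (2*pi)) = 1"
    by (metis cis_multiple_2pi Ints_of_int mult.commute)
  ultimately show ?thesis
    using False by (simp add: integral_unique)
qed (simp add: scaleR_conv_of_real)

subsection \<open>Decomposition of alpha-harmonic functions\<close>

lemma one_minus_mult_norm_pos:
  assumes "cmod z < 1" "t \<in> {0..1}"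
  shows "0 < 1 - t * (cmod z)\<^sup>2"
proof -
  have "(cmod z)\<^sup>2 < 1"
    using assms(1) by (simp add: power_less_one_iff abs_square_less_1)
  moreover have "t * (cmod z)\<^sup>2 \<le> 1 * (cmod z)\<^sup>2"
    using assms(2) by (intro mult_right_mono) auto
  ultimately show ?thesis
    by simp
qed

text \<open>The parameter \<open>t\<close> lets one formula cover the weight itself
  (\<open>t = 1\<close>) and the weight inside the radial integral; it is the chain rule for
  \<open>z \<bullet> z\<close>, with \<open>2 * (z \<bullet> v)\<close> split into its complex
  linear and conjugate linear parts.\<close>

lemma has_derivative_weight:
  fixes \<beta> :: real
  assumes "0 < 1 - t * (cmod z)\<^sup>2"
  defines "c \<equiv> complex_of_real (- t * \<beta> * (1 - t * (cmod z)\<^sup>2) powr (\<beta> - 1))"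
  shows "((\<lambda>z. complex_of_real ((1 - t * (cmod z)\<^sup>2) powr \<beta>)) has_derivative
      (\<lambda>v. c * cnj z * v + c * z * cnj v)) (at z)"
proof -
  have inner: "complex_of_real (2 * (z \<bullet> v)) = cnj z * v + z * cnj v" for v
    by (simp add: complex_eq_iff inner_complex_def)
  have "((\<lambda>z. (1 - t * (z \<bullet> z)) powr \<beta>) has_derivative
      (\<lambda>v. - t * \<beta> * (1 - t * (z \<bullet> z)) powr (\<beta> - 1) * (2 * (z \<bullet> v)))) (at z)"
    using assms(1)
    by (auto intro!: derivative_eq_intros simp: power2_norm_eq_inner powr_diff inner_commute field_simps)
  from has_derivative_of_real[OF this, where 'a = complex] show ?thesis
    unfolding of_real_mult[of _ "2 * (z \<bullet> _)"] inner
    by (simp add: c_def power2_norm_eq_inner algebra_simps)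
qed

text \<open>Once \<open>d_z g\<close> vanishes, the real derivative of \<open>g\<close> is
  \<open>v \<mapsto> b * cnj v\<close>. Conjugating turns it into multiplication by
  \<open>cnj b\<close>, which is complex differentiability of \<open>cnj g\<close>.\<close>

lemma alpha_harmonic_d_zbar:
  fixes f :: "complex \<Rightarrow> complex"
  assumes "alpha_harmonic \<alpha> f"
  obtains H :: "complex \<Rightarrow> complex" where "H holomorphic_on ball 0 1"
    "\<And>z. z \<in> ball 0 1 \<Longrightarrow> d_zbar f z = of_real ((1 - (cmod z)\<^sup>2) powr \<alpha>) * cnj (H z)"
proof
  define g where "g w = complex_of_real ((1 - (cmod w)\<^sup>2) powr (- \<alpha>)) * d_zbar f w" for w
  show "(\<lambda>w. cnj (g w)) holomorphic_on ball 0 1"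
  proof (rule holomorphic_onI)
    fix z :: complex
    assume z: "z \<in> ball 0 1"
    have diff: "partial_x f differentiable (at z)" "partial_y f differentiable (at z)"
      using assms z by (auto simp: alpha_harmonic_def C2_on_def C1_on_def)
    then have "d_zbar f differentiable (at z)"
      unfolding d_zbar_def[abs_def] divide_inverse
      by (intro differentiable_mult differentiable_add differentiable_const)
    moreover have "(\<lambda>w. complex_of_real ((1 - (cmod w)\<^sup>2) powr (- \<alpha>))) differentiable (at z)"
      using has_derivative_weight[of 1 z "- \<alpha>"] one_minus_mult_norm_pos[of z 1] z
      by (auto simp: differentiable_def)
    ultimately have "g differentiable (at z)"
      unfolding g_def[abs_def] by (intro differentiable_mult)
    from has_derivative_wirtinger[OF this]
    have "(g has_derivative (\<lambda>v. d_z g z * v + d_zbar g z * cnj v)) (at z)" .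
    moreover have "d_z g z = 0"
      using assms z by (simp add: alpha_harmonic_def weighted_laplacian_def g_def[abs_def])
    ultimately have "((\<lambda>w. cnj (g w)) has_derivative (\<lambda>v. cnj (d_zbar g z) * v)) (at z)"
      using has_derivative_cnj[of g "\<lambda>v. d_zbar g z * cnj v" "at z"] by simp
    then show "(\<lambda>w. cnj (g w)) field_differentiable (at z within ball 0 1)"
      unfolding field_differentiable_def has_field_derivative_def
      using has_derivative_at_withinI by blast
  qed
  show "d_zbar f z = of_real ((1 - (cmod z)\<^sup>2) powr \<alpha>) * cnj (cnj (g z))" if "z \<in> ball 0 1" for z
  proof -
    have "(1 - (cmod z)\<^sup>2) powr \<alpha> * (1 - (cmod z)\<^sup>2) powr (- \<alpha>) = 1"
      using one_minus_mult_norm_pos[of z 1] that by (simp flip: powr_add)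
    then show ?thesis
      by (simp add: g_def flip: mult.assoc of_real_mult)
  qed
qed

text \<open>Treat \<open>z\<close> and \<open>cnj z\<close> as independent variables and integrate
  the prescribed z-bar derivative in \<open>cnj z\<close> from 0: the path \<open>t * cnj z\<close>
  with \<open>z\<close> frozen turns the weight into
  \<open>(1 - t * |z|\<^sup>2) powr \<alpha>\<close>.\<close>

definition dbar_potential :: "real \<Rightarrow> (complex \<Rightarrow> complex) \<Rightarrow> complex \<Rightarrow> complex" where
  "dbar_potential \<alpha> H z = integral {0..1} (\<lambda>t.
     cnj z * cnj (H (of_real t * z)) * of_real ((1 - t * (cmod z)\<^sup>2) powr \<alpha>))"

text \<open>
  The \<open>z\<close>-bar derivative of the integrand of \<^const>\<open>dbar_potential\<close> is the \<open>t\<close>-derivative of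
  \<open>t cnj (H (t z)) (1 - t |z|\<^sup>2) powr \<alpha>\<close>.
\<close>

lemma has_derivative_dbar_potential:
  assumes H: "H holomorphic_on ball 0 1" and z0: "z0 \<in> ball 0 1"
  shows "\<exists>a. (dbar_potential \<alpha> H has_derivative
      (\<lambda>v. a * v + of_real ((1 - (cmod z0)\<^sup>2) powr \<alpha>) * cnj (H z0) * cnj v)) (at z0)"
proof -
  define W where "W \<beta> z t = complex_of_real ((1 - t * (cmod z)\<^sup>2) powr \<beta>)" for \<beta> z t
  define c where "c z t = complex_of_real (- t * \<alpha>) * W (\<alpha> - 1) z t" for z t
  define A where "A z t = cnj z * cnj (H (of_real t * z)) * (c z t * cnj z)" for z t
  define B where "B z t = cnj (H (of_real t * z)) * W \<alpha> z t
      + cnj z * cnj (of_real t * deriv H (of_real t * z)) * W \<alpha> z t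
      + cnj z * cnj (H (of_real t * z)) * (c z t * z)" for z t
  have in_ball: "of_real t * z \<in> ball 0 1" if "z \<in> ball 0 1" "t \<in> {0..1}" for z :: complex and t
  proof -
    have "\<bar>t\<bar> * cmod z \<le> 1 * cmod z"
      using that by (intro mult_right_mono) auto
    then show ?thesis
      using that by (simp add: norm_mult)
  qed
  have dH: "(H has_field_derivative deriv H w) (at w)" if "w \<in> ball 0 1" for w
    using H holomorphic_derivI open_ball that by blast
  have holo_cont: "continuous_on (ball 0 1 \<times> {0..1}) (\<lambda>(z, t). h (of_real t * z))"
    if "h holomorphic_on ball 0 1" for h :: "complex \<Rightarrow> complex"
    unfolding case_prod_unfold
    by (rule continuous_on_compose2[OF holomorphic_on_imp_continuous_on[OF that]])
       (use in_ball in \<open>auto intro!: continuous_intros\<close>)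
  have W_cont: "continuous_on (ball 0 1 \<times> {0..1}) (\<lambda>(z, t). W \<beta> z t)" for \<beta>
    unfolding W_def case_prod_unfold
    by (intro continuous_intros) (use one_minus_mult_norm_pos in fastforce)
  note conts = holo_cont[OF H] holo_cont[OF holomorphic_deriv[OF H open_ball]] W_cont
  note conts' = conts[unfolded case_prod_unfold]
  have slice: "continuous_on {0..1} (h z)"
    if "continuous_on (ball 0 1 \<times> {0..1}) (\<lambda>(z, t). h z t)" "z \<in> ball 0 1"
    for h :: "complex \<Rightarrow> real \<Rightarrow> complex" and z
    using continuous_on_compose2[OF that(1) continuous_on_Pair[OF continuous_on_const[of "{0..1}" z] continuous_on_id]] that(2)
    by (simp add: image_subset_iff)
  have "((\<lambda>z. integral {0..1} (\<lambda>t. cnj z * cnj (H (of_real t * z)) * W \<alpha> z t)) has_derivative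
      (\<lambda>v. integral {0..1} (A z0) * v + integral {0..1} (B z0) * cnj v)) (at z0)"
  proof (rule leibniz_rule_wirtinger)
    fix z :: complex and t :: real
    assume z: "z \<in> ball 0 1" and t: "t \<in> {0..1}"
    have "((\<lambda>z. H (of_real t * z)) has_field_derivative deriv H (of_real t * z) * of_real t) (at z)"
      by (rule DERIV_chain2[where g = "\<lambda>z. of_real t * z", OF dH[OF in_ball[OF z t]]])
         (auto intro!: derivative_eq_intros)
    then have 1: "((\<lambda>z. cnj (H (of_real t * z))) has_derivative
        (\<lambda>v. cnj (deriv H (of_real t * z) * of_real t * v))) (at z)"
      unfolding has_field_derivative_def by (rule has_derivative_cnj)
    have 2: "((\<lambda>z. W \<alpha> z t) has_derivative (\<lambda>v. c z t * cnj z * v + c z t * z * cnj v)) (at z)"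
      using has_derivative_weight[of t z \<alpha>] one_minus_mult_norm_pos[of z t] z t
      by (simp add: W_def c_def)
    show "((\<lambda>z. cnj z * cnj (H (of_real t * z)) * W \<alpha> z t) has_derivative
        (\<lambda>v. A z t * v + B z t * cnj v)) (at z)"
      by (rule has_derivative_eq_rhs[OF has_derivative_mult[OF has_derivative_mult[OF
            has_derivative_cnj[OF has_derivative_ident] 1] 2]])
         (simp add: A_def B_def fun_eq_iff algebra_simps)
  next
    show "(\<lambda>t. cnj z * cnj (H (of_real t * z)) * W \<alpha> z t) integrable_on {0..1}" if "z \<in> ball 0 1" for z
      by (intro integrable_continuous_real continuous_intros slice conts(1)
          slice[OF W_cont] slice[of "\<lambda>z t. H (of_real t * z)"] that)
  next
    show "continuous_on (ball 0 1 \<times> {0..1}) (\<lambda>(z, t). A z t)"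
      unfolding A_def c_def case_prod_unfold by (intro continuous_intros conts')
    show "continuous_on (ball 0 1 \<times> {0..1}) (\<lambda>(z, t). B z t)"
      unfolding B_def c_def case_prod_unfold by (intro continuous_intros conts')
  qed (use z0 in auto)
  moreover have "(B z0 has_integral W \<alpha> z0 1 * cnj (H z0)) {0..1}"
  proof -
    define T where "T t = of_real t * (cnj (H (of_real t * z0)) * W \<alpha> z0 t)" for t
    have "(T has_vector_derivative B z0 t) (at t within {0..1})" if t: "t \<in> {0..1}" for t
    proof -
      have "((\<lambda>x. H (x * z0)) has_field_derivative deriv H (of_real t * z0) * z0) (at (of_real t))"
        by (rule DERIV_chain2[where g = "\<lambda>x. x * z0", OF dH[OF in_ball[OF z0 t]]])
           (auto intro!: derivative_eq_intros)
      then have 1: "((\<lambda>t. cnj (H (of_real t * z0))) has_vector_derivative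
          cnj (deriv H (of_real t * z0) * z0)) (at t within {0..1})"
        by (intro has_vector_derivative_cnj has_vector_derivative_real_field)
      have pos: "0 < 1 - t * (cmod z0)\<^sup>2"
        using one_minus_mult_norm_pos z0 t by simp
      have "((\<lambda>t. (1 - t * (cmod z0)\<^sup>2) powr \<alpha>) has_real_derivative
          (- \<alpha> * (1 - t * (cmod z0)\<^sup>2) powr (\<alpha> - 1) * (cmod z0)\<^sup>2)) (at t within {0..1})"
        using pos by (auto intro!: derivative_eq_intros simp: powr_diff field_simps)
      from has_vector_derivative_of_real[OF this, where 'a = complex]
      have 2: "(W \<alpha> z0 has_vector_derivative
          - of_real \<alpha> * W (\<alpha> - 1) z0 t * (z0 * cnj z0)) (at t within {0..1})"
        by (simp add: W_def[abs_def] flip: complex_norm_square)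
      have 3: "(complex_of_real has_vector_derivative 1) (at t within {0..1})"
        using has_vector_derivative_of_real[OF DERIV_ident, where 'a = complex] by simp
      show ?thesis
        unfolding T_def[abs_def]
        by (rule has_vector_derivative_eq_rhs[OF has_vector_derivative_mult[OF 3
              has_vector_derivative_mult[OF 1 2]]])
           (simp add: B_def c_def algebra_simps)
    qed
    then have "(B z0 has_integral (T 1 - T 0)) {0..1}"
      by (intro fundamental_theorem_of_calculus) auto
    then show ?thesis
      by (simp add: T_def mult.commute)
  qed
  ultimately show ?thesis
    unfolding dbar_potential_def[abs_def] W_def by (auto simp: integral_unique)
qed

lemma alpha_harmonic_decomposition:
  fixes f :: "complex \<Rightarrow> complex"
  assumes "alpha_harmonic \<alpha> f"
  obtains F H :: "complex \<Rightarrow> complex" where "F holomorphic_on ball 0 1" "H holomorphic_on ball 0 1"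
    "\<And>z. z \<in> ball 0 1 \<Longrightarrow> f z = F z + dbar_potential \<alpha> H z"
proof -
  obtain H where H: "H holomorphic_on ball 0 1"
    "\<And>z. z \<in> ball 0 1 \<Longrightarrow> d_zbar f z = of_real ((1 - (cmod z)\<^sup>2) powr \<alpha>) * cnj (H z)"
    using alpha_harmonic_d_zbar[OF assms] by metis
  have "(\<lambda>z. f z - dbar_potential \<alpha> H z) holomorphic_on ball 0 1"
  proof (rule holomorphic_onI)
    fix z :: complex
    assume z: "z \<in> ball 0 1"
    then have "f differentiable (at z)"
      using assms by (auto simp: alpha_harmonic_def C2_on_def C1_on_def)
    note f = has_derivative_wirtinger[OF this]
    \<comment> \<open>The value of \<open>a\<close> is immaterial: the conjugate linear parts
      cancel, and what remains is multiplication by \<open>d_z f z - a\<close>.\<close>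
    obtain a where "(dbar_potential \<alpha> H has_derivative
        (\<lambda>v. a * v + of_real ((1 - (cmod z)\<^sup>2) powr \<alpha>) * cnj (H z) * cnj v)) (at z)"
      using has_derivative_dbar_potential[OF H(1) z] by blast
    from has_derivative_diff[OF f this]
    have "((\<lambda>z. f z - dbar_potential \<alpha> H z) has_derivative (\<lambda>v. (d_z f z - a) * v)) (at z)"
      using H(2)[OF z] by (simp add: algebra_simps)
    then show "(\<lambda>z. f z - dbar_potential \<alpha> H z) field_differentiable (at z within ball 0 1)"
      unfolding field_differentiable_def has_field_derivative_def
      using has_derivative_at_withinI by blast
  qed
  then show thesis
    using that[of "\<lambda>z. f z - dbar_potential \<alpha> H z" H] H(1) by simp
qed

subsection \<open>Trigonometric series and the mean of the Poisson kernel\<close>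

text \<open>Euler's limit formula for Gamma at \<open>\<alpha> + 1\<close>, \<open>1\<close> and
  twice at \<open>\<alpha>/2 + 1\<close>. The powers of \<open>n\<close> cancel because
  \<open>(\<alpha> + 1) + 1 = 2 * (\<alpha>/2 + 1)\<close>; the factor at \<open>1\<close> tends to
  1 and supplies the factorial.\<close>

lemma pochhammer_quotient_tendsto:
  assumes "\<alpha> > -1"
  shows "(\<lambda>n. (pochhammer (\<alpha>/2 + 1) n)\<^sup>2 / (fact n * pochhammer (\<alpha> + 1) n)) \<longlonglongrightarrow> 1 / c_const \<alpha>"
proof -
  have "(\<lambda>n. Gamma_series (\<alpha> + 1) n * Gamma_series 1 n / (Gamma_series (\<alpha>/2 + 1) n)\<^sup>2)
      \<longlonglongrightarrow> Gamma (\<alpha> + 1) * Gamma 1 / (Gamma (\<alpha>/2 + 1))\<^sup>2"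
    using assms by (intro tendsto_intros) (auto simp: Gamma_eq_zero_iff nonpos_Ints_def)
  then have lim: "(\<lambda>n. Gamma_series (\<alpha> + 1) n * Gamma_series 1 n / (Gamma_series (\<alpha>/2 + 1) n)\<^sup>2)
      \<longlonglongrightarrow> 1 / c_const \<alpha>"
    by (simp add: c_const_def)
  have quotient: "(f * E1 / P1) * (f * E0 / Q) / (f * E / P)\<^sup>2 = P\<^sup>2 / (Q * P1)"
    if "E1 = E\<^sup>2 / E0" "E \<noteq> 0" "E0 \<noteq> 0" "f \<noteq> 0" "P \<noteq> 0" "P1 \<noteq> 0" "Q \<noteq> 0"
    for E E0 E1 f P P1 Q :: real
    using that(2-) unfolding that(1) by (simp add: divide_simps power2_eq_square)
  have "Gamma_series (\<alpha> + 1) n * Gamma_series 1 n / (Gamma_series (\<alpha>/2 + 1) n)\<^sup>2 =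
      (pochhammer (\<alpha>/2 + 1) (Suc n))\<^sup>2 / (pochhammer 1 (Suc n) * pochhammer (\<alpha> + 1) (Suc n))" for n
  proof -
    have pos: "pochhammer b (Suc n) > 0" if "b > 0" for b :: real
      using that by (rule pochhammer_pos)
    have E: "exp ((\<alpha> + 1) * ln (real n)) = (exp ((\<alpha>/2 + 1) * ln (real n)))\<^sup>2 / exp (1 * ln (real n))"
      unfolding power2_eq_square exp_add[symmetric] exp_diff[symmetric] by (simp add: algebra_simps)
    show ?thesis
      unfolding Gamma_series_def of_real_eq_id id_apply Suc_eq_plus1[symmetric]
      by (rule quotient[OF E exp_not_eq_zero exp_not_eq_zero fact_nonzero])
         (use assms pos[of "\<alpha>/2 + 1"] pos[of 1] pos[of "\<alpha> + 1"] in linarith)+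
  qed
  then have "Gamma_series (\<alpha> + 1) n * Gamma_series 1 n / (Gamma_series (\<alpha>/2 + 1) n)\<^sup>2 =
      (pochhammer (\<alpha>/2 + 1) (Suc n))\<^sup>2 / (fact (Suc n) * pochhammer (\<alpha> + 1) (Suc n))" for n
    by (simp only: pochhammer_fact)
  \<comment> \<open>\<open>Gamma_series\<close> at \<open>n\<close> contains the Pochhammer symbol
    of order \<open>n + 1\<close>, so the limit was obtained for the shifted sequence.\<close>
  from lim[unfolded this] show ?thesis
    by (rule LIMSEQ_imp_Suc)
qed

text \<open>
  The quotient of the two sides increases with \<open>n\<close>, because
  \<open>(n + 1)(n + \<alpha> + 1) \<le> (n + \<alpha>/2 + 1)\<^sup>2\<close>, towards the limit computed above.
\<close>

lemma pochhammer_sq_le: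
  assumes "\<alpha> > -1"
  shows "(pochhammer (\<alpha>/2 + 1) n / fact n)\<^sup>2 \<le> 1 / c_const \<alpha> * (pochhammer (\<alpha> + 1) n / fact n)"
proof -
  define X where "X n = (pochhammer (\<alpha>/2 + 1) n)\<^sup>2 / (fact n * pochhammer (\<alpha> + 1) n)" for n
  have pos: "pochhammer (\<alpha> + 1) n > 0" for n
    using assms by (intro pochhammer_pos) simp
  have "incseq X"
  proof (rule incseq_SucI)
    show "X n \<le> X (Suc n)" for n
    proof -
      have nz: "(real n + 1) * (\<alpha> + 1 + real n) > 0"
        using assms by (intro mult_pos_pos) auto
      \<comment> \<open>The right side exceeds the left by
        \<open>\<alpha>\<^sup>2 / 4\<close>.\<close>
      have "(real n + 1) * (\<alpha> + 1 + real n) \<le> (\<alpha>/2 + 1 + real n)\<^sup>2"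
        by (simp add: power2_eq_square field_simps)
      then have "1 \<le> (\<alpha>/2 + 1 + real n)\<^sup>2 / ((real n + 1) * (\<alpha> + 1 + real n))"
        using nz by (simp add: pos_le_divide_eq)
      moreover have "X n \<ge> 0"
        using pos[of n] by (simp add: X_def)
      ultimately have le: "X n * 1 \<le> X n * ((\<alpha>/2 + 1 + real n)\<^sup>2 / ((real n + 1) * (\<alpha> + 1 + real n)))"
        by (intro mult_left_mono)
      have "x\<^sup>2 / (f * q) * (y\<^sup>2 / (m * r)) = (x * y)\<^sup>2 / ((m * f) * (q * r))" for x y f q m r :: real
        by (simp only: power_mult_distrib times_divide_times_eq ac_simps)
      then have "X n * ((\<alpha>/2 + 1 + real n)\<^sup>2 / ((real n + 1) * (\<alpha> + 1 + real n))) = X (Suc n)"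
        by (simp only: X_def pochhammer_Suc fact_Suc of_nat_Suc add.commute[of 1 "real n"])
      with le show ?thesis
        by simp
    qed
  qed
  moreover have "X \<longlonglongrightarrow> 1 / c_const \<alpha>"
    using pochhammer_quotient_tendsto[OF assms] by (simp add: X_def[abs_def])
  ultimately have "X n \<le> 1 / c_const \<alpha>"
    by (rule incseq_le)
  then have "X n * (pochhammer (\<alpha> + 1) n / fact n) \<le> 1 / c_const \<alpha> * (pochhammer (\<alpha> + 1) n / fact n)"
    using pos[of n] by (intro mult_right_mono) auto
  moreover have "X n * (pochhammer (\<alpha> + 1) n / fact n) = (pochhammer (\<alpha>/2 + 1) n / fact n)\<^sup>2"
    using pos[of n] by (simp add: X_def power2_eq_square)
  ultimately show ?thesis
    by simp
qed

lemma binomial_series_neg_powr: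
  fixes w :: complex
  assumes "cmod w < 1"
  shows "(\<lambda>n. of_real (pochhammer b n / fact n) * w ^ n) sums ((1 - w) powr (- of_real b))"
proof -
  have "(- complex_of_real b gchoose n) * (- w) ^ n =
      (- 1) ^ n * (- 1) ^ n * (of_real (pochhammer b n / fact n) * w ^ n)" for n
    unfolding gbinomial_pochhammer power_minus[of w] by (simp add: pochhammer_of_real)
  then have "(- complex_of_real b gchoose n) * (- w) ^ n = of_real (pochhammer b n / fact n) * w ^ n" for n
    by (simp flip: power_mult_distrib)
  then show ?thesis
    using gen_binomial_complex[of "- w" "- complex_of_real b"] assms by simp
qed

text \<open>The frequencies \<open>k n\<close> are kept arbitrary so that the same termwise
  integration covers the increasing sequence \<open>n\<close> and the decreasing ones
  \<open>-n\<close> and \<open>-(n + 1)\<close>.\<close>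

lemma trig_series_integral:
  fixes a :: "nat \<Rightarrow> complex" and k :: "nat \<Rightarrow> int"
  assumes a: "summable (\<lambda>n. norm (a n))"
    and F: "\<And>t. (\<lambda>n. a n * cis (of_int (k n) * t)) sums F t"
  shows "continuous_on {0..2*pi} F"
    and "(\<lambda>n. a n * (if k n + j = 0 then 2 * pi else 0)) sums
      integral {0..2*pi} (\<lambda>t. F t * cis (of_int j * t))"
proof -
  show "continuous_on {0..2*pi} F"
    by (rule sums_integral_weierstrass(2)[OF _ _ a F]) (auto simp: norm_mult intro!: continuous_intros)
  have "(\<lambda>n. integral {0..2*pi} (\<lambda>t. a n * cis (of_int (k n) * t) * cis (of_int j * t))) sums
      integral {0..2*pi} (\<lambda>t. F t * cis (of_int j * t))"
    by (rule sums_integral_weierstrass(1)[OF _ _ a])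
      (auto simp: norm_mult intro!: continuous_intros sums_mult2 F)
  moreover have "integral {0..2*pi} (\<lambda>t. a n * cis (of_int (k n) * t) * cis (of_int j * t)) =
      a n * (if k n + j = 0 then 2 * pi else 0)" for n
  proof -
    have "(\<lambda>t. a n * cis (of_int (k n) * t) * cis (of_int j * t)) =
        (\<lambda>t. a n * cis (of_int (k n + j) * t))"
      by (simp add: mult.assoc cis_mult distrib_right)
    then show ?thesis
      by (simp only: integral_mult_right integral_cis_int)
  qed
  ultimately show "(\<lambda>n. a n * (if k n + j = 0 then 2 * pi else 0)) sums
      integral {0..2*pi} (\<lambda>t. F t * cis (of_int j * t))"
    by simp
qed

text \<open>Absolute summability makes the series uniformly convergent. Multiply the conjugate
  series by the bounded function \<open>F\<close> and integrate term by term: each integral is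
  \<open>cnj (a n)\<close> times the Fourier coefficient \<open>2 * pi * a n\<close>.\<close>

lemma parseval:
  fixes a :: "nat \<Rightarrow> complex"
  assumes a: "summable (\<lambda>n. norm (a n))"
    and F: "\<And>t. (\<lambda>n. a n * cis (- (real n * t))) sums F t"
  shows "(\<lambda>n. 2 * pi * (norm (a n))\<^sup>2) sums integral {0..2*pi} (\<lambda>t. (norm (F t))\<^sup>2)"
proof -
  have F': "\<And>t. (\<lambda>n. a n * cis (of_int (- int n) * t)) sums F t"
    using F by simp
  have contF: "continuous_on {0..2*pi} F"
    by (rule trig_series_integral(1)[OF a F'])
  have coeff: "integral {0..2*pi} (\<lambda>t. F t * cis (real n * t)) = 2 * pi * a n" for n
  proof -
    have "(\<lambda>m. a m * (if - int m + int n = 0 then 2 * pi else 0)) sums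
        integral {0..2*pi} (\<lambda>t. F t * cis (of_int (int n) * t))"
      by (rule trig_series_integral(2)[OF a F'])
    moreover have "(\<lambda>m. a m * (if - int m + int n = 0 then 2 * pi else 0)) =
        (\<lambda>m. if m = n then a m * (2 * pi) else 0)"
      by auto
    ultimately show ?thesis
      using sums_unique2[OF sums_single[of n "\<lambda>m. a m * (2 * pi)"]] by (simp add: mult.commute)
  qed
  obtain B where B: "\<And>t. t \<in> {0..2*pi} \<Longrightarrow> norm (F t) \<le> B"
    using compact_imp_bounded[OF compact_continuous_image[OF contF compact_Icc]]
    by (metis bounded_iff imageI)
  have "(\<lambda>n. integral {0..2*pi} (\<lambda>t. cnj (a n) * (F t * cis (real n * t)))) sums
      integral {0..2*pi} (\<lambda>t. cnj (F t) * F t)"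
  proof (rule sums_integral_weierstrass(1))
    show "summable (\<lambda>n. norm (a n) * B)"
      by (intro summable_mult2 a)
    show "norm (cnj (a n) * (F t * cis (real n * t))) \<le> norm (a n) * B" if "t \<in> {0..2*pi}" for n t
      using B[OF that] by (auto simp: norm_mult intro!: mult_left_mono)
    show "(\<lambda>n. cnj (a n) * (F t * cis (real n * t))) sums (cnj (F t) * F t)" for t
    proof -
      have "(\<lambda>n. cnj (a n * cis (- (real n * t)))) sums cnj (F t)"
        using F[of t] by (subst sums_cnj)
      from sums_mult2[OF this, of "F t"] show ?thesis
        by (simp add: cis_cnj mult_ac)
    qed
  qed (intro continuous_intros contF)
  moreover have "integral {0..2*pi} (\<lambda>t. cnj (a n) * (F t * cis (real n * t))) =
      of_real (2 * pi * (norm (a n))\<^sup>2)" for n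
    unfolding integral_mult_right coeff
    by (simp add: mult.commute[of "cnj (a n)"] flip: complex_norm_square)
  moreover have "integral {0..2*pi} (\<lambda>t. cnj (F t) * F t) =
      of_real (integral {0..2*pi} (\<lambda>t. (norm (F t))\<^sup>2))"
  proof -
    have "((\<lambda>t. (norm (F t))\<^sup>2) has_integral integral {0..2*pi} (\<lambda>t. (norm (F t))\<^sup>2)) {0..2*pi}"
      by (intro integrable_integral integrable_continuous_real continuous_intros contF)
    from has_integral_of_real[OF this, where ?'b = complex]
    have "((\<lambda>t. cnj (F t) * F t) has_integral
        of_real (integral {0..2*pi} (\<lambda>t. (norm (F t))\<^sup>2))) {0..2*pi}"
      by (simp add: mult.commute[of "cnj (F _)"] flip: complex_norm_square)
    then show ?thesis
      by (rule integral_unique)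
  qed
  ultimately show ?thesis
    by (simp only: sums_of_real_iff)
qed

lemma power_series_abs_summable:
  fixes a :: "nat \<Rightarrow> complex" and H :: "complex \<Rightarrow> complex"
  assumes sums: "\<And>w. cmod w < 1 \<Longrightarrow> (\<lambda>n. a n * w ^ n) sums H w" and z: "cmod z < 1"
  shows "summable (\<lambda>n. norm (a n * z ^ n))"
proof -
  obtain r where r: "cmod z < r" "r < 1"
    using dense[OF z] by auto
  then have "r > 0"
    using norm_ge_zero[of z] by linarith
  with r show ?thesis
    by (intro powser_insidea[OF sums_summable[OF sums[of "of_real r"]]]) auto
qed

text \<open>The power \<open>-(\<alpha> + 2)\<close> of the modulus is the square of the modulus of
  a holomorphic function with half the exponent, \<open>-(\<alpha>/2 + 1)\<close>; this is where the
  argument \<open>\<alpha>/2 + 1\<close> in \<open>c_const\<close> comes from. The bound does not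
  depend on \<open>z\<close> because the comparison series sums to a power of
  \<open>1 - |z|\<^sup>2\<close> that cancels the numerator.\<close>

lemma integral_norm_kernel_le:
  assumes \<alpha>: "\<alpha> > -1" and z: "cmod z < 1"
  shows "integral {0..2*pi} (\<lambda>t. (1 - (cmod z)\<^sup>2) powr (\<alpha> + 1) / cmod (1 - z * cis (- t)) powr (\<alpha> + 2))
    \<le> 2 * pi / c_const \<alpha>" 
proof -
  define b where "b n = pochhammer (\<alpha>/2 + 1) n / fact n" for n :: nat
  define a where "a n = complex_of_real (b n) * z ^ n" for n
  define F where "F t = (1 - z * cis (- t)) powr (- of_real (\<alpha>/2 + 1))" for t
  have z2: "(cmod z)\<^sup>2 < 1"
    using z by (simp add: power_less_one_iff abs_square_less_1)
  have b_sums: "(\<lambda>n. of_real (b n) * w ^ n) sums ((1 - w) powr (- of_real (\<alpha>/2 + 1)))"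
    if "cmod w < 1" for w :: complex
    unfolding b_def by (rule binomial_series_neg_powr[OF that])
  have "summable (\<lambda>n. norm (a n))"
    unfolding a_def by (rule power_series_abs_summable[OF b_sums z])
  moreover have "(\<lambda>n. a n * cis (- (real n * t))) sums F t" for t
    using b_sums[of "z * cis (- t)"] z
    by (simp add: F_def a_def norm_mult power_mult_distrib Complex.DeMoivre mult.assoc)
  ultimately have "(\<lambda>n. 2 * pi * (norm (a n))\<^sup>2) sums integral {0..2*pi} (\<lambda>t. (norm (F t))\<^sup>2)"
    by (rule parseval)
  moreover have "(\<lambda>n. 2 * pi * (1 / c_const \<alpha> * (pochhammer (\<alpha> + 1) n / fact n * ((cmod z)\<^sup>2) ^ n)))
      sums (2 * pi * (1 / c_const \<alpha> * (1 - (cmod z)\<^sup>2) powr (- (\<alpha> + 1))))"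
  proof (intro sums_mult)
    have "(\<lambda>n. complex_of_real (pochhammer (\<alpha> + 1) n / fact n * ((cmod z)\<^sup>2) ^ n)) sums
        ((1 - complex_of_real ((cmod z)\<^sup>2)) powr (- of_real (\<alpha> + 1)))"
      using binomial_series_neg_powr[of "of_real ((cmod z)\<^sup>2)" "\<alpha> + 1"] z2
      by (simp only: of_real_mult of_real_power[of "(cmod z)\<^sup>2"] norm_of_real abs_power2)
    also have "(1 - complex_of_real ((cmod z)\<^sup>2)) powr (- of_real (\<alpha> + 1)) =
        of_real ((1 - (cmod z)\<^sup>2) powr (- (\<alpha> + 1)))"
      using powr_of_real[of "1 - (cmod z)\<^sup>2" "- (\<alpha> + 1)"] z2 by simp
    finally show "(\<lambda>n. pochhammer (\<alpha> + 1) n / fact n * ((cmod z)\<^sup>2) ^ n) sums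
        (1 - (cmod z)\<^sup>2) powr (- (\<alpha> + 1))"
      by (simp only: sums_of_real_iff)
  qed
  moreover have "2 * pi * (norm (a n))\<^sup>2 \<le>
      2 * pi * (1 / c_const \<alpha> * (pochhammer (\<alpha> + 1) n / fact n * ((cmod z)\<^sup>2) ^ n))" for n
  proof -
    have "(norm (a n))\<^sup>2 = (b n)\<^sup>2 * ((cmod z)\<^sup>2) ^ n"
      by (simp add: a_def norm_mult norm_power power_mult_distrib power_commutes flip: power_mult)
         (simp add: mult.commute)
    also have "\<dots> \<le> 1 / c_const \<alpha> * (pochhammer (\<alpha> + 1) n / fact n) * ((cmod z)\<^sup>2) ^ n"
      unfolding b_def by (intro mult_right_mono pochhammer_sq_le \<alpha>) auto
    finally show ?thesis
      unfolding mult.assoc by (intro mult_left_mono) auto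
  qed
  ultimately have le: "integral {0..2*pi} (\<lambda>t. (norm (F t))\<^sup>2) \<le>
      2 * pi * (1 / c_const \<alpha> * (1 - (cmod z)\<^sup>2) powr (- (\<alpha> + 1)))"
    by (rule sums_le[rotated 1])
  have "(norm (F t))\<^sup>2 = 1 / cmod (1 - z * cis (- t)) powr (\<alpha> + 2)" for t
  proof -
    have "norm (F t) = cmod (1 - z * cis (- t)) powr (- (\<alpha>/2 + 1))"
      unfolding F_def using norm_powr_real_powr'[of "- of_real (\<alpha>/2 + 1)"] by simp
    also have "\<dots>\<^sup>2 = cmod (1 - z * cis (- t)) powr (- (\<alpha> + 2))"
      by (simp add: power2_eq_square flip: powr_add)
    finally show ?thesis
      by (simp only: powr_minus_divide)
  qed
  then have "integral {0..2*pi} (\<lambda>t. (1 - (cmod z)\<^sup>2) powr (\<alpha> + 1) / cmod (1 - z * cis (- t)) powr (\<alpha> + 2)) =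
      (1 - (cmod z)\<^sup>2) powr (\<alpha> + 1) * integral {0..2*pi} (\<lambda>t. (norm (F t))\<^sup>2)"
    by (simp flip: integral_mult_right)
  also have "\<dots> \<le> (1 - (cmod z)\<^sup>2) powr (\<alpha> + 1) *
      (2 * pi * (1 / c_const \<alpha> * (1 - (cmod z)\<^sup>2) powr (- (\<alpha> + 1))))"
    by (intro mult_left_mono le) auto
  also have "\<dots> = 2 * pi / c_const \<alpha> * ((1 - (cmod z)\<^sup>2) powr (\<alpha> + 1) * (1 - (cmod z)\<^sup>2) powr (- (\<alpha> + 1)))"
    by simp
  also have "\<dots> = 2 * pi / c_const \<alpha>"
    using z2 by (simp flip: powr_add)
  finally show ?thesis .
qed

subsection \<open>Power series of the potential\<close>

text \<open>The incomplete beta function with parameters \<open>m + 1\<close> and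
  \<open>\<alpha> + 1\<close>, divided by \<open>x ^ Suc m\<close>. In this form it is regular at
  \<open>x = 0\<close>, with value \<open>1 / (m + 1)\<close>, so the series of the potential also
  covers the origin.\<close>

definition inc_beta :: "real \<Rightarrow> nat \<Rightarrow> real \<Rightarrow> real" where
  "inc_beta \<alpha> m x = integral {0..1} (\<lambda>t. t ^ m * (1 - t * x) powr \<alpha>)"

text \<open>The weight is monotone in \<open>t\<close>, in a direction that depends on the sign of
  \<alpha>; the maximum of its values at \<open>t = 0\<close> and \<open>t = 1\<close> covers both
  cases.\<close>

lemma weight_powr_le:
  fixes x t \<alpha> :: real
  assumes "x \<in> {0..<1}" "t \<in> {0..1}"
  shows "(1 - t * x) powr \<alpha> \<le> max 1 ((1 - x) powr \<alpha>)"
proof -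
  have "0 \<le> t * x" "t * x \<le> x"
    using assms mult_left_le_one_le[of x t] by auto
  then show ?thesis
    using assms powr_mono2'[of "- \<alpha>" "1 - x" "1 - t * x"] powr_le1[of \<alpha> "1 - t * x"]
      powr_mono2'[of \<alpha> "1 - x" "1 - t * x"]
    by (cases "\<alpha> \<ge> 0") (auto simp: le_max_iff_disj)
qed

lemma continuous_on_inc_beta_integrand:
  fixes x \<alpha> :: real
  assumes "x < 1" "0 \<le> x"
  shows "continuous_on {0..1} (\<lambda>t. t ^ m * (1 - t * x) powr \<alpha>)"
proof -
  have "1 - t * x \<noteq> 0" if "t \<in> {0..1}" for t
    using that assms mult_left_le_one_le[of x t] by auto
  then show ?thesis
    by (intro continuous_intros) blast
qed

lemma inc_beta_bounds:
  assumes "x \<in> {0..<1}"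
  shows "0 \<le> inc_beta \<alpha> m x" "inc_beta \<alpha> m x \<le> max 1 ((1 - x) powr \<alpha>)"
proof -
  have int: "(\<lambda>t. t ^ m * (1 - t * x) powr \<alpha>) integrable_on {0..1}"
    using assms by (intro integrable_continuous_real continuous_on_inc_beta_integrand) auto
  show "0 \<le> inc_beta \<alpha> m x"
    unfolding inc_beta_def by (rule integral_nonneg[OF int]) auto
  have "inc_beta \<alpha> m x \<le> integral {0..1} (\<lambda>t::real. max 1 ((1 - x) powr \<alpha>))"
    unfolding inc_beta_def
  proof (rule integral_le[OF int])
    fix t :: real
    assume t: "t \<in> {0..1}"
    have "t ^ m * (1 - t * x) powr \<alpha> \<le> 1 * max 1 ((1 - x) powr \<alpha>)"
      using t by (intro mult_mono weight_powr_le assms power_le_one) auto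
    then show "t ^ m * (1 - t * x) powr \<alpha> \<le> max 1 ((1 - x) powr \<alpha>)"
      by simp
  qed auto
  then show "inc_beta \<alpha> m x \<le> max 1 ((1 - x) powr \<alpha>)"
    by simp
qed

lemma norm_power2_less_one: "cmod z < 1 \<Longrightarrow> (cmod z)\<^sup>2 \<in> {0..<1}"
  by (simp add: power_less_one_iff abs_square_less_1)

lemma inc_beta_series_summable:
  fixes h :: "nat \<Rightarrow> complex"
  assumes "summable (\<lambda>n. norm (h n * z ^ n))" "cmod z < 1"
  shows "summable (\<lambda>m. norm (cnj (h m) * cnj z ^ Suc m * of_real (inc_beta \<alpha> m ((cmod z)\<^sup>2))))"
proof (rule summable_comparison_test', rule summable_mult2, rule assms(1))
  fix m :: nat
  have "norm (cnj (h m) * cnj z ^ Suc m * of_real (inc_beta \<alpha> m ((cmod z)\<^sup>2))) =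
      norm (h m * z ^ m) * (cmod z * inc_beta \<alpha> m ((cmod z)\<^sup>2))"
    using inc_beta_bounds(1)[OF norm_power2_less_one[OF assms(2)]] by (simp add: norm_mult norm_power)
  also have "\<dots> \<le> norm (h m * z ^ m) * (1 * max 1 ((1 - (cmod z)\<^sup>2) powr \<alpha>))"
    using inc_beta_bounds[OF norm_power2_less_one[OF assms(2)]] assms(2)
    by (intro mult_left_mono mult_mono) auto
  finally show "norm (norm (cnj (h m) * cnj z ^ Suc m * of_real (inc_beta \<alpha> m ((cmod z)\<^sup>2)))) \<le>
      norm (h m * z ^ m) * (1 * max 1 ((1 - (cmod z)\<^sup>2) powr \<alpha>))"
    by simp
qed

text \<open>Expanding \<open>H\<close> under the integral leaves a radial factor times
  \<open>cnj z ^ Suc m\<close>. The potential therefore has only negative frequencies on each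
  circle, which separates it from the holomorphic part.\<close>

lemma dbar_potential_sums:
  fixes h :: "nat \<Rightarrow> complex" and H :: "complex \<Rightarrow> complex"
  assumes sums: "\<And>w. cmod w < 1 \<Longrightarrow> (\<lambda>n. h n * w ^ n) sums H w" and z: "cmod z < 1"
  shows "(\<lambda>m. cnj (h m) * cnj z ^ Suc m * of_real (inc_beta \<alpha> m ((cmod z)\<^sup>2))) sums dbar_potential \<alpha> H z"
proof -
  define x where "x = (cmod z)\<^sup>2"
  have x: "x \<in> {0..<1}"
    unfolding x_def by (rule norm_power2_less_one[OF z])
  define C where "C = max 1 ((1 - x) powr \<alpha>)"
  define g where "g m t = cnj z * cnj (h m * (of_real t * z) ^ m) * complex_of_real ((1 - t * x) powr \<alpha>)" for m t
  have g: "g m t = cnj (h m) * cnj z ^ Suc m * of_real (t ^ m * (1 - t * x) powr \<alpha>)" for m t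
    by (simp add: g_def power_mult_distrib mult_ac)
  have cont: "continuous_on {0..1} (\<lambda>t. t ^ m * (1 - t * x) powr \<alpha>)" for m
    using x by (intro continuous_on_inc_beta_integrand) auto
  have "(\<lambda>m. integral {0..1} (g m)) sums
      integral {0..1} (\<lambda>t. cnj z * cnj (H (of_real t * z)) * of_real ((1 - t * x) powr \<alpha>))"
  proof (rule sums_integral_weierstrass(1))
    show "continuous_on {0..1} (g m)" for m
      unfolding g[abs_def] by (intro continuous_intros cont)
    show "summable (\<lambda>m. norm (h m * z ^ m) * C)"
      by (intro summable_mult2 power_series_abs_summable[OF sums z])
    show "norm (g m t) \<le> norm (h m * z ^ m) * C" if t: "t \<in> {0..1}" for m t
    proof -
      have "norm (g m t) = norm (h m * z ^ m) * (cmod z * t ^ m * (1 - t * x) powr \<alpha>)"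
        using t by (simp add: g norm_mult norm_power mult_ac abs_mult)
      also have "cmod z * t ^ m * (1 - t * x) powr \<alpha> \<le> 1 * 1 * C"
        unfolding C_def using t z by (intro mult_mono weight_powr_le x power_le_one) auto
      finally show ?thesis
        by (simp add: mult_left_mono)
    qed
    show "(\<lambda>m. g m t) sums (cnj z * cnj (H (of_real t * z)) * of_real ((1 - t * x) powr \<alpha>))"
      if t: "t \<in> {0..1}" for t
    proof -
      have "cmod (of_real t * z) < 1"
        using t z mult_left_le_one_le[of "cmod z" t] by (auto simp: norm_mult)
      from sums[OF this] have "(\<lambda>m. cnj (h m * (of_real t * z) ^ m)) sums cnj (H (of_real t * z))"
        by (subst sums_cnj)
      then show ?thesis
        unfolding g_def by (intro sums_mult sums_mult2)
    qed
  qed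
  moreover have "integral {0..1} (g m) = cnj (h m) * cnj z ^ Suc m * of_real (inc_beta \<alpha> m x)" for m
    unfolding g[abs_def] integral_mult_right inc_beta_def
    by (intro arg_cong[where f = "\<lambda>u. cnj (h m) * cnj z ^ Suc m * u"] integral_unique has_integral_of_real
        integrable_integral integrable_continuous_real cont)
  ultimately show ?thesis
    by (simp add: dbar_potential_def x_def)
qed

text \<open>The substitution \<open>s = x * t\<close> moves \<open>x\<close> from the integrand into
  the upper limit of integration.\<close>

lemma inc_beta_rescale:
  assumes "0 < x" "x < 1"
  shows "x ^ Suc m * inc_beta \<alpha> m x = integral {0..x} (\<lambda>s. s ^ m * (1 - s) powr \<alpha>)"
proof -
  have "(\<lambda>s. s / x) ` {0..x} = {0..1}"
    using assms by (simp add: image_divide_atLeastAtMost)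
  then have "integral {0..1} (\<lambda>t. (x * t) ^ m * (1 - x * t) powr \<alpha>) =
      1 / \<bar>x\<bar> * integral {0..x} (\<lambda>s. s ^ m * (1 - s) powr \<alpha>)"
    using integral_stretch_real[of x 0 x "\<lambda>s. s ^ m * (1 - s) powr \<alpha>"] assms by simp
  moreover have "integral {0..1} (\<lambda>t. (x * t) ^ m * (1 - x * t) powr \<alpha>) = x ^ m * inc_beta \<alpha> m x"
    unfolding inc_beta_def integral_mult_right[symmetric] by (simp add: power_mult_distrib mult_ac)
  ultimately show ?thesis
    using assms by (simp add: field_simps)
qed

text \<open>For \<open>\<alpha> < 0\<close> the integrand of \<open>inc_beta\<close> blows up at
  \<open>t = 1\<close> as \<open>x\<close> tends to 1, so there is no uniform limit under the
  integral. After rescaling, the limit is the continuity of an indefinite integral at its right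
  endpoint, which rests on integrability of \<open>s ^ m * (1 - s) powr \<alpha>\<close> alone,
  hence on \<open>\<alpha> > -1\<close>.\<close>

lemma inc_beta_tendsto:
  assumes \<alpha>: "\<alpha> > -1"
  shows "((\<lambda>r. r ^ Suc m * inc_beta \<alpha> m (r\<^sup>2)) \<longlongrightarrow> Beta (real (Suc m)) (\<alpha> + 1)) (at_left 1)"
proof -
  define G where "G x = integral {0..x} (\<lambda>s. s ^ m * (1 - s) powr \<alpha>)" for x :: real
  \<comment> \<open>The point 0 is exempted because for \<open>m = 0\<close> the Beta integrand has
    \<open>0 powr 0 = 0\<close> there, whereas \<open>0 ^ 0 = 1\<close>.\<close>
  have hi: "((\<lambda>s. s ^ m * (1 - s) powr \<alpha>) has_integral Beta (real (Suc m)) (\<alpha> + 1)) {0..1}"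
    by (rule has_integral_spike_finite[OF _ _ has_integral_Beta_real[of "real (Suc m)" "\<alpha> + 1"], of "{0}"])
      (use \<alpha> in \<open>auto simp: powr_realpow\<close>)
  then have "continuous_on {0..1} G"
    unfolding G_def by (intro indefinite_integral_continuous_1 has_integral_integrable)
  then have "(G \<longlongrightarrow> G 1) (at 1 within {0..1})"
    by (simp add: continuous_on_def)
  then have lim1: "(G \<longlongrightarrow> Beta (real (Suc m)) (\<alpha> + 1)) (at_left 1)"
    using integral_unique[OF hi] by (simp add: G_def at_within_Icc_at_left)
  have "filterlim (\<lambda>r::real. r\<^sup>2) (at_left 1) (at_left 1)"
  proof (intro filterlim_at_withinI eventually_conj)
    show "((\<lambda>r::real. r\<^sup>2) \<longlongrightarrow> 1) (at_left 1)"
      by (rule tendsto_eq_intros | simp)+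
    show "\<forall>\<^sub>F r in at_left 1. (r::real)\<^sup>2 \<in> {..<1} - {1}"
      using eventually_at_left[of 0 "1::real"]
      by (auto simp: eventually_at_left[of 0 "1::real"] power_less_one_iff abs_square_less_1 intro!: exI[of _ 0])
  qed
  \<comment> \<open>With \<open>x = r\<^sup>2\<close> the rescaled integral carries \<open>r\<close>
    to the power \<open>2 * Suc m\<close>; half of it is divided off, since
    \<open>cnj z ^ Suc m\<close> supplies only \<open>r ^ Suc m\<close>.\<close>
  from filterlim_compose[OF lim1 this]
  have "((\<lambda>r. G (r\<^sup>2) / r ^ Suc m) \<longlongrightarrow> Beta (real (Suc m)) (\<alpha> + 1) / 1 ^ Suc m) (at_left 1)"
    by (intro tendsto_intros) auto
  moreover have "\<forall>\<^sub>F r in at_left 1. G (r\<^sup>2) / r ^ Suc m = r ^ Suc m * inc_beta \<alpha> m (r\<^sup>2)"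
  proof -
    have "G (r\<^sup>2) / r ^ Suc m = r ^ Suc m * inc_beta \<alpha> m (r\<^sup>2)" if r: "0 < r" "r < 1" for r :: real
    proof -
      have "G (r\<^sup>2) = (r\<^sup>2) ^ Suc m * inc_beta \<alpha> m (r\<^sup>2)"
        unfolding G_def by (rule inc_beta_rescale[symmetric]) (use r in \<open>auto simp: power_less_one_iff\<close>)
      also have "(r\<^sup>2) ^ Suc m = r ^ Suc m * r ^ Suc m"
        by (simp add: power2_eq_square power_mult_distrib)
      finally show ?thesis
        using r by simp
    qed
    then show ?thesis
      unfolding eventually_at_left[of 0 "1::real", simplified] by (intro exI[of _ 0]) auto
  qed
  ultimately show ?thesis
    using tendsto_cong by fastforce
qed

lemma smooth_on_circle_cis:
  assumes "\<And>t. \<phi> (cis t) = cis (of_int k * t)"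
  shows "smooth_on_circle \<phi>"
  unfolding smooth_on_circle_def
proof (intro exI[of _ "\<lambda>n t. (\<i> * of_int k) ^ n * cis (of_int k * t)"] conjI allI)
  show "(\<lambda>t. (\<i> * of_int k) ^ 0 * cis (of_int k * t)) = (\<lambda>t. \<phi> (cis t))"
    using assms by simp
  show "((\<lambda>t. (\<i> * of_int k) ^ n * cis (of_int k * t)) has_vector_derivative
      (\<i> * of_int k) ^ Suc n * cis (of_int k * t)) (at t)" for n t
  proof -
    define c where "c = \<i> * of_int k"
    have cis: "cis (of_int k * t) = exp (c * of_real t)" for t
      by (simp add: c_def cis_conv_exp mult.assoc)
    have "((\<lambda>t. c ^ n * exp (c * of_real t)) has_vector_derivative c ^ Suc n * exp (c * of_real t)) (at t)"
      by (rule has_vector_derivative_real_field) (auto intro!: derivative_eq_intros)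
    then show ?thesis
      unfolding cis c_def .
  qed
qed

subsection \<open>Boundary coefficients\<close>

text \<open>Starting the second series at frequency -1, not at 0, keeps the two frequency sets
  disjoint, so every exponential tests exactly one coefficient of one series.\<close>

lemma two_sided_trig_coeff:
  fixes a c :: "nat \<Rightarrow> complex"
  assumes a: "summable (\<lambda>n. norm (a n))" and c: "summable (\<lambda>n. norm (c n))"
    and P: "\<And>t. (\<lambda>n. a n * cis (of_int (int n) * t)) sums P t"
    and N: "\<And>t. (\<lambda>n. c n * cis (of_int (- int (Suc n)) * t)) sums N t"
  shows "integral {0..2*pi} (\<lambda>t. (P t + N t) * cis (of_int (- int n) * t)) = 2 * pi * a n"
    and "integral {0..2*pi} (\<lambda>t. (P t + N t) * cis (of_int (int (Suc n)) * t)) = 2 * pi * c n"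
proof -
  have split: "integral {0..2*pi} (\<lambda>t. (P t + N t) * cis (of_int j * t)) =
      integral {0..2*pi} (\<lambda>t. P t * cis (of_int j * t)) + integral {0..2*pi} (\<lambda>t. N t * cis (of_int j * t))" for j
    unfolding distrib_right
    by (intro integral_add integrable_continuous_real continuous_intros
        trig_series_integral(1)[OF a P] trig_series_integral(1)[OF c N])
  note aP = trig_series_integral(2)[OF a P] and cN = trig_series_integral(2)[OF c N]
  have delta: "(\<lambda>m. b m * (if m = n then 2 * pi else 0)) sums (b n * (2 * pi))" for b :: "nat \<Rightarrow> complex"
    using sums_single[of n "\<lambda>m. b m * (2 * pi)"] by (simp add: if_distrib cong: if_cong)
  have "integral {0..2*pi} (\<lambda>t. P t * cis (of_int (- int n) * t)) = a n * (2 * pi)"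
    by (rule sums_unique2[OF aP]) (use delta[of a] in simp)
  moreover have "integral {0..2*pi} (\<lambda>t. N t * cis (of_int (- int n) * t)) = 0"
    by (rule sums_unique2[OF cN]) (simp add: add_eq_0_iff)
  ultimately show "integral {0..2*pi} (\<lambda>t. (P t + N t) * cis (of_int (- int n) * t)) = 2 * pi * a n"
    unfolding split by simp
  have "integral {0..2*pi} (\<lambda>t. N t * cis (of_int (int (Suc n)) * t)) = c n * (2 * pi)"
    by (rule sums_unique2[OF cN]) (use delta[of c] in \<open>simp add: eq_commute[of n]\<close>)
  moreover have "integral {0..2*pi} (\<lambda>t. P t * cis (of_int (int (Suc n)) * t)) = 0"
    by (rule sums_unique2[OF aP]) (simp add: add_eq_0_iff)
  ultimately show "integral {0..2*pi} (\<lambda>t. (P t + N t) * cis (of_int (int (Suc n)) * t)) = 2 * pi * c n"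
    unfolding split by simp
qed

lemma boundary_coefficients:
  fixes A h :: "nat \<Rightarrow> complex" and f g F H :: "complex \<Rightarrow> complex"
  assumes \<alpha>: "\<alpha> > -1"
    and A: "\<And>w. cmod w < 1 \<Longrightarrow> (\<lambda>n. A n * w ^ n) sums F w"
    and h: "\<And>w. cmod w < 1 \<Longrightarrow> (\<lambda>n. h n * w ^ n) sums H w"
    and f: "\<And>w. cmod w < 1 \<Longrightarrow> f w = F w + dbar_potential \<alpha> H w"
    and bv: "distributional_boundary_value f g"
  shows "integral {0..2*pi} (\<lambda>t. g (cis t) * cis (- (real n * t))) = 2 * pi * A n"
    and "integral {0..2*pi} (\<lambda>t. g (cis t) * cis (real (Suc n) * t)) =
      2 * pi * (cnj (h n) * of_real (Beta (real (Suc n)) (\<alpha> + 1)))"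
proof -
  \<comment> \<open>Coefficient of frequency \<open>-(n + 1)\<close> of the potential on the circle
    of radius \<open>r\<close>.\<close>
  define c where "c r n = cnj (h n) * of_real (r ^ Suc n * inc_beta \<alpha> n (r\<^sup>2))" for r n
  have coeffs:
    "integral {0..2*pi} (\<lambda>t. f (of_real r * cis t) * cis (of_int (- int n) * t)) = 2 * pi * (A n * of_real r ^ n)"
    "integral {0..2*pi} (\<lambda>t. f (of_real r * cis t) * cis (of_int (int (Suc n)) * t)) = 2 * pi * c r n"
    if r: "0 < r" "r < 1" for r
  proof -
    have norm_r: "cmod (of_real r * cis t) = r" for t
      using r by (simp add: norm_mult)
    have P: "(\<lambda>n. (A n * of_real r ^ n) * cis (of_int (int n) * t)) sums F (of_real r * cis t)" for t
      using A[of "of_real r * cis t"] r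
      by (simp add: norm_r power_mult_distrib Complex.DeMoivre mult.assoc)
    have N: "(\<lambda>n. c r n * cis (of_int (- int (Suc n)) * t)) sums dbar_potential \<alpha> H (of_real r * cis t)" for t
    proof -
      have rotate: "cnj (of_real r * cis t) ^ Suc n = of_real (r ^ Suc n) * cis (of_int (- int (Suc n)) * t)" for n
        by (simp add: power_mult_distrib Complex.DeMoivre cis_cnj algebra_simps del: power_Suc)
      have "cmod (of_real r * cis t) < 1"
        using r norm_r by simp
      then have "(\<lambda>m. cnj (h m) * cnj (of_real r * cis t) ^ Suc m *
          of_real (inc_beta \<alpha> m ((cmod (of_real r * cis t))\<^sup>2))) sums dbar_potential \<alpha> H (of_real r * cis t)"
        by (intro dbar_potential_sums h)
      then show ?thesis
        unfolding norm_r rotate by (simp add: c_def mult_ac del: power_Suc of_nat_Suc)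
    qed
    have sA: "summable (\<lambda>n. norm (A n * of_real r ^ n))"
      using r by (intro power_series_abs_summable[OF A]) auto
    have "summable (\<lambda>m. norm (cnj (h m) * cnj (of_real r) ^ Suc m * of_real (inc_beta \<alpha> m ((cmod (of_real r))\<^sup>2))))"
      using r by (intro inc_beta_series_summable power_series_abs_summable[OF h]) auto
    then have sc: "summable (\<lambda>n. norm (c r n))"
      by (simp add: c_def mult.assoc)
    have "f (of_real r * cis t) = F (of_real r * cis t) + dbar_potential \<alpha> H (of_real r * cis t)" for t
      using r by (intro f) (simp add: norm_r)
    then show "integral {0..2*pi} (\<lambda>t. f (of_real r * cis t) * cis (of_int (- int n) * t)) = 2 * pi * (A n * of_real r ^ n)"
      "integral {0..2*pi} (\<lambda>t. f (of_real r * cis t) * cis (of_int (int (Suc n)) * t)) = 2 * pi * c r n"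
      using two_sided_trig_coeff[OF sA sc P N, of n] by simp_all
  qed
  \<comment> \<open>Test functions live on the plane but only their values on the circle count;
    \<open>\<phi>\<close> is any extension of the exponential, below \<open>cnj z ^ n\<close> and
    \<open>z ^ Suc n\<close>.\<close>
  have unique: "integral {0..2*pi} (\<lambda>t. g (cis t) * cis (of_int k * t)) = L"
    if \<phi>: "\<And>t. \<phi> (cis t) = cis (of_int k * t)"
      and eq: "\<And>r. 0 < r \<Longrightarrow> r < 1 \<Longrightarrow>
        integral {0..2*pi} (\<lambda>t. f (of_real r * cis t) * cis (of_int k * t)) = u r"
      and lim: "(u \<longlongrightarrow> L) (at_left 1)" for \<phi> k u L
  proof -
    have "((\<lambda>r. integral {0..2*pi} (\<lambda>t. f (of_real r * cis t) * cis (of_int k * t)))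
        \<longlongrightarrow> integral {0..2*pi} (\<lambda>t. g (cis t) * cis (of_int k * t))) (at_left 1)"
      using bv[unfolded distributional_boundary_value_def, rule_format, OF smooth_on_circle_cis[OF \<phi>]]
      by (simp only: \<phi>)
    moreover have "\<forall>\<^sub>F r in at_left 1.
        integral {0..2*pi} (\<lambda>t. f (of_real r * cis t) * cis (of_int k * t)) = u r"
      using eventually_at_left_real[OF zero_less_one] by (rule eventually_mono) (auto intro: eq)
    ultimately have "(u \<longlongrightarrow> integral {0..2*pi} (\<lambda>t. g (cis t) * cis (of_int k * t))) (at_left 1)"
      by (rule Lim_transform_eventually)
    then show ?thesis
      using lim tendsto_unique[of "at_left (1::real)"] by simp
  qed
  have "integral {0..2*pi} (\<lambda>t. g (cis t) * cis (of_int (- int n) * t)) = 2 * pi * (A n * of_real 1 ^ n)"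
  proof (rule unique[of "\<lambda>z. cnj z ^ n", OF _ coeffs(1)])
    show "((\<lambda>r. 2 * pi * (A n * of_real r ^ n)) \<longlongrightarrow> 2 * pi * (A n * of_real 1 ^ n)) (at_left 1)"
      by (intro tendsto_intros)
  qed (auto simp: cis_cnj Complex.DeMoivre)
  then show "integral {0..2*pi} (\<lambda>t. g (cis t) * cis (- (real n * t))) = 2 * pi * A n"
    by simp
  have "integral {0..2*pi} (\<lambda>t. g (cis t) * cis (of_int (int (Suc n)) * t)) =
      2 * pi * (cnj (h n) * of_real (Beta (real (Suc n)) (\<alpha> + 1)))"
  proof (rule unique[of "\<lambda>z. z ^ Suc n", OF _ coeffs(2)])
    show "((\<lambda>r. 2 * pi * c r n) \<longlongrightarrow>
        2 * pi * (cnj (h n) * of_real (Beta (real (Suc n)) (\<alpha> + 1)))) (at_left 1)"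
      unfolding c_def by (intro tendsto_intros inc_beta_tendsto \<alpha>)
  qed (auto simp: Complex.DeMoivre simp del: power_Suc of_nat_Suc)
  then show "integral {0..2*pi} (\<lambda>t. g (cis t) * cis (real (Suc n) * t)) =
      2 * pi * (cnj (h n) * of_real (Beta (real (Suc n)) (\<alpha> + 1)))"
    by simp
qed

section \<open>Closed form of the Poisson type kernel\<close>

text \<open>The right side is the Taylor coefficient of
  \<open>(\<alpha> + 1) * (1 - w) powr (- (\<alpha> + 2))\<close>, so removing the Beta factors from
  the boundary coefficients leads to the potential of that function.\<close>

lemma inverse_Beta_Suc:
  fixes \<alpha> :: real
  assumes "\<alpha> > -1"
  shows "1 / Beta (real (Suc m)) (\<alpha> + 1) = (\<alpha> + 1) * (pochhammer (\<alpha> + 2) m / fact m)"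
proof -
  have nonint: "\<alpha> + 1 \<notin> \<int>\<^sub>\<le>\<^sub>0" "\<alpha> + 2 \<notin> \<int>\<^sub>\<le>\<^sub>0"
    using assms by (auto simp: nonpos_Ints_def)
  have "Gamma (\<alpha> + 2) = (\<alpha> + 1) * Gamma (\<alpha> + 1)"
    using Gamma_plus1[OF nonint(1)] by (simp add: add.assoc)
  moreover have "pochhammer (\<alpha> + 2) m = Gamma (\<alpha> + 2 + real m) / Gamma (\<alpha> + 2)"
    by (rule pochhammer_Gamma[OF nonint(2)])
  moreover have "Gamma (real (Suc m)) = fact m"
    using Gamma_fact[of m, where 'a = real] by (simp add: add.commute)
  moreover have "Gamma (\<alpha> + 1) > 0" "Gamma (\<alpha> + 2 + real m) > 0"
    using assms by (auto intro: Gamma_real_pos)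
  moreover have "Beta (real (Suc m)) (\<alpha> + 1) =
      Gamma (real (Suc m)) * Gamma (\<alpha> + 1) / Gamma (\<alpha> + 2 + real m)"
  proof -
    have "real (Suc m) + (\<alpha> + 1) = \<alpha> + 2 + real m"
      by simp
    then show ?thesis
      by (simp only: Beta_def)
  qed
  ultimately show ?thesis
    using assms by (simp del: of_nat_Suc)
qed

text \<open>This is \<open>(1 - |w|\<^sup>2) powr (\<alpha> + 1)\<close> over
  \<open>(1 - w) * (1 - cnj w) powr (\<alpha> + 1)\<close>, taken at
  \<open>w = z * cis (- t)\<close>; for \<open>\<alpha> = 0\<close> it is the classical Poisson
  kernel.\<close>

definition alpha_poisson_kernel :: "real \<Rightarrow> complex \<Rightarrow> complex" where
  "alpha_poisson_kernel \<alpha> w =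
     of_real ((1 - (cmod w)\<^sup>2) powr (\<alpha> + 1)) * cnj ((1 - w) powr (- of_real (\<alpha> + 1))) / (1 - w)"

lemma powr_one_minus_has_field_derivative:
  assumes "cmod w < 1"
  shows "((\<lambda>w. (1 - w) powr (- of_real b)) has_field_derivative
      of_real b * (1 - w) powr (- of_real (b + 1))) (at w)"
proof -
  have "1 - w \<notin> \<real>\<^sub>\<le>\<^sub>0"
    using assms complex_Re_le_cmod[of w] by (auto simp: complex_nonpos_Reals_iff)
  then show ?thesis
    by (auto intro!: derivative_eq_intros simp: mult.commute)
qed

lemma powr_one_minus_add1:
  assumes "cmod w < 1"
  shows "(1 - w) powr (- of_real b) = (1 - w) * (1 - w) powr (- of_real (b + 1))"
proof -
  have "1 - w \<noteq> 0"
    using assms by auto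
  then have "(1 - w) powr (- of_real b) = (1 - w) powr 1 * (1 - w) powr (- of_real (b + 1))"
    unfolding powr_add[symmetric] by simp
  then show ?thesis
    using \<open>1 - w \<noteq> 0\<close> by simp
qed

text \<open>
  Up to the factor \<open>1 - z\<close>, the integrand of the potential has the antiderivative
  \<open>((1 - t |z|\<^sup>2) / (1 - t cnj z)) powr (\<alpha> + 1)\<close>.
\<close>

lemma alpha_poisson_kernel_eq:
  assumes z: "cmod z < 1"
  shows "1 / (1 - z) + dbar_potential \<alpha> (\<lambda>w. of_real (\<alpha> + 1) * (1 - w) powr (- of_real (\<alpha> + 2))) z =
    alpha_poisson_kernel \<alpha> z"
proof -
  define W where "W \<beta> t = complex_of_real ((1 - t * (cmod z)\<^sup>2) powr \<beta>)" for \<beta> t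
  define Q where "Q \<beta> t = cnj ((1 - of_real t * z) powr (- of_real \<beta>))" for \<beta> and t :: real
  define k where "k t = cnj z * cnj (of_real (\<alpha> + 1) * (1 - of_real t * z) powr (- of_real (\<alpha> + 2))) * W \<alpha> t" for t
  have "((\<lambda>t. W (\<alpha> + 1) t * Q (\<alpha> + 1) t) has_vector_derivative (1 - z) * k t) (at t within {0..1})"
    if t: "t \<in> {0..1}" for t
  proof -
    have tz: "cmod (of_real t * z) < 1"
      using t z mult_left_le_one_le[of "cmod z" t] by (auto simp: norm_mult)
    have pos: "0 < 1 - t * (cmod z)\<^sup>2"
      using one_minus_mult_norm_pos z t by simp
    have "((\<lambda>x. (1 - x * z) powr (- of_real (\<alpha> + 1))) has_field_derivative
        of_real (\<alpha> + 1) * (1 - of_real t * z) powr (- of_real (\<alpha> + 1 + 1)) * z) (at (of_real t))"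
      by (rule DERIV_chain2[where g = "\<lambda>x. x * z", OF powr_one_minus_has_field_derivative[OF tz]])
         (auto intro!: derivative_eq_intros)
    from has_vector_derivative_cnj[OF has_vector_derivative_real_field[OF this]]
    have Q: "(Q (\<alpha> + 1) has_vector_derivative of_real (\<alpha> + 1) * Q (\<alpha> + 2) t * cnj z) (at t within {0..1})"
      by (simp add: Q_def[abs_def] add.assoc)
    have "((\<lambda>t. (1 - t * (cmod z)\<^sup>2) powr \<beta>) has_real_derivative
        (- \<beta> * (1 - t * (cmod z)\<^sup>2) powr (\<beta> - 1) * (cmod z)\<^sup>2)) (at t within {0..1})" for \<beta>
      using pos by (auto intro!: derivative_eq_intros simp: powr_diff field_simps)
    from has_vector_derivative_of_real[OF this[of "\<alpha> + 1"], where 'a = complex]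
    have W: "(W (\<alpha> + 1) has_vector_derivative - of_real (\<alpha> + 1) * W \<alpha> t * (z * cnj z)) (at t within {0..1})"
      by (simp add: W_def[abs_def] flip: complex_norm_square)
    have W_add1: "W (\<alpha> + 1) t = W \<alpha> t * (1 - of_real t * (z * cnj z))"
      using pos unfolding W_def by (simp add: powr_add flip: complex_norm_square)
    have Q_add1: "Q (\<alpha> + 1) t = (1 - of_real t * cnj z) * Q (\<alpha> + 2) t"
      unfolding Q_def using powr_one_minus_add1[OF tz, of "\<alpha> + 1"] by (simp add: add.assoc)
    have k: "k t = cnj z * (of_real (\<alpha> + 1) * Q (\<alpha> + 2) t) * W \<alpha> t"
      by (simp add: k_def Q_def)
    show ?thesis
      by (rule has_vector_derivative_eq_rhs[OF has_vector_derivative_mult[OF W Q]])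
         (simp only: W_add1 Q_add1 k, simp add: algebra_simps)
  qed
  then have "((\<lambda>t. (1 - z) * k t) has_integral (W (\<alpha> + 1) 1 * Q (\<alpha> + 1) 1 - W (\<alpha> + 1) 0 * Q (\<alpha> + 1) 0)) {0..1}"
    by (intro fundamental_theorem_of_calculus) auto
  \<comment> \<open>The antiderivative is 1 at \<open>t = 0\<close>; after division by
    \<open>1 - z\<close> this cancels the geometric term \<open>1 / (1 - z)\<close>.\<close>
  then have "(1 - z) * integral {0..1} k = W (\<alpha> + 1) 1 * Q (\<alpha> + 1) 1 - 1"
    by (simp add: integral_unique W_def Q_def flip: integral_mult_right)
  moreover have "integral {0..1} k =
      dbar_potential \<alpha> (\<lambda>w. of_real (\<alpha> + 1) * (1 - w) powr (- of_real (\<alpha> + 2))) z"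
    by (simp add: k_def[abs_def] W_def dbar_potential_def)
  moreover have "1 - z \<noteq> 0"
    using z by auto
  ultimately show ?thesis
    by (simp add: alpha_poisson_kernel_def W_def Q_def field_simps)
qed

subsection \<open>Derivatives of the kernel\<close>

definition kernel_dz :: "real \<Rightarrow> complex \<Rightarrow> complex" where
  "kernel_dz \<alpha> w = of_real ((1 - (cmod w)\<^sup>2) powr \<alpha>) * cnj ((1 - w) powr (- of_real (\<alpha> + 1))) *
     ((1 - cnj w) - of_real \<alpha> * cnj w * (1 - w)) / (1 - w)\<^sup>2"

definition kernel_dzbar :: "real \<Rightarrow> complex \<Rightarrow> complex" where
  "kernel_dzbar \<alpha> w =
     of_real ((\<alpha> + 1) * (1 - (cmod w)\<^sup>2) powr \<alpha>) * cnj ((1 - w) powr (- of_real (\<alpha> + 2)))"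

text \<open>The product rule collapses through two identities. In the z-bar part
  \<open>(1 - w * cnj w) - w * (1 - cnj w) = 1 - w\<close> cancels the denominator; in the z part
  \<open>(1 - w * cnj w) - cnj w * (1 - w) = 1 - cnj w\<close> gives the numerator of
  \<open>kernel_dz\<close>.\<close>

lemma has_derivative_alpha_poisson_kernel:
  assumes w: "cmod w < 1"
  shows "(alpha_poisson_kernel \<alpha> has_derivative
    (\<lambda>v. kernel_dz \<alpha> w * v + kernel_dzbar \<alpha> w * cnj v)) (at w)"
proof -
  define W where "W = complex_of_real ((1 - (cmod w)\<^sup>2) powr \<alpha>)"
  define Q where "Q = cnj ((1 - w) powr (- of_real (\<alpha> + 2)))"
  have pos: "0 < 1 - 1 * (cmod w)\<^sup>2"
    using one_minus_mult_norm_pos[of w 1] w by simp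
  have w1: "1 - w \<noteq> 0"
    using w by auto
  have "((\<lambda>w. complex_of_real ((1 - (cmod w)\<^sup>2) powr (\<alpha> + 1))) has_derivative
      (\<lambda>v. - of_real (\<alpha> + 1) * W * cnj w * v - of_real (\<alpha> + 1) * W * w * cnj v)) (at w)"
    by (rule has_derivative_eq_rhs, use has_derivative_weight[OF pos, of "\<alpha> + 1"] in simp)
       (simp add: fun_eq_iff W_def algebra_simps)
  moreover have "((\<lambda>w. cnj ((1 - w) powr (- of_real (\<alpha> + 1)))) has_derivative
      (\<lambda>v. of_real (\<alpha> + 1) * Q * cnj v)) (at w)"
    by (rule has_derivative_eq_rhs[OF has_derivative_cnj[OF
          powr_one_minus_has_field_derivative[OF w, of "\<alpha> + 1", unfolded has_field_derivative_def]]])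
       (simp add: Q_def add.assoc)
  moreover have "((\<lambda>w. 1 / (1 - w)) has_derivative (\<lambda>v. 1 / (1 - w)\<^sup>2 * v)) (at w)"
    unfolding has_field_derivative_def[symmetric]
    using w1 by (auto intro!: derivative_eq_intros simp: power2_eq_square)
  ultimately have D: "((\<lambda>w. of_real ((1 - (cmod w)\<^sup>2) powr (\<alpha> + 1)) *
        cnj ((1 - w) powr (- of_real (\<alpha> + 1))) * (1 / (1 - w))) has_derivative
      (\<lambda>v. of_real ((1 - (cmod w)\<^sup>2) powr (\<alpha> + 1)) * cnj ((1 - w) powr (- of_real (\<alpha> + 1))) *
          (1 / (1 - w)\<^sup>2 * v) +
        (of_real ((1 - (cmod w)\<^sup>2) powr (\<alpha> + 1)) * (of_real (\<alpha> + 1) * Q * cnj v) +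
         (- of_real (\<alpha> + 1) * W * cnj w * v - of_real (\<alpha> + 1) * W * w * cnj v) *
           cnj ((1 - w) powr (- of_real (\<alpha> + 1)))) * (1 / (1 - w)))) (at w)"
    by (intro has_derivative_mult)
  have W1: "complex_of_real ((1 - (cmod w)\<^sup>2) powr (\<alpha> + 1)) = W * (1 - w * cnj w)"
    using pos unfolding W_def by (simp add: powr_add flip: complex_norm_square)
  have Q1: "cnj ((1 - w) powr (- of_real (\<alpha> + 1))) = (1 - cnj w) * Q"
    unfolding Q_def using powr_one_minus_add1[OF w, of "\<alpha> + 1"] by (simp add: add.assoc)
  have dz: "kernel_dz \<alpha> w = W * ((1 - cnj w) * Q) * ((1 - cnj w) - of_real \<alpha> * cnj w * (1 - w)) / (1 - w)\<^sup>2"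
    by (simp only: kernel_dz_def Q1 W_def)
  have dzbar: "kernel_dzbar \<alpha> w = of_real (\<alpha> + 1) * W * Q"
    by (simp add: kernel_dzbar_def Q_def W_def)
  have "W * (1 - w * cnj w) * ((1 - cnj w) * Q) * (1 / (1 - w)\<^sup>2 * v) +
        (W * (1 - w * cnj w) * (of_real (\<alpha> + 1) * Q * cnj v) +
         (- of_real (\<alpha> + 1) * W * cnj w * v - of_real (\<alpha> + 1) * W * w * cnj v) *
           ((1 - cnj w) * Q)) * (1 / (1 - w)) =
      kernel_dz \<alpha> w * v + kernel_dzbar \<alpha> w * cnj v" for v
  proof -
    \<comment> \<open>With the denominator as an atom, clearing it leaves a polynomial
      identity.\<close>
    define u where "u = 1 - w"
    have u: "w = 1 - u" "u \<noteq> 0"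
      using w1 by (auto simp: u_def)
    show ?thesis
      unfolding dz dzbar using u(2) unfolding u(1)
      by (simp add: field_simps power2_eq_square)
  qed
  then show ?thesis
    using D unfolding W1 Q1 alpha_poisson_kernel_def[abs_def] by (simp add: W1 Q1)
qed

lemma continuous_on_kernels:
  "continuous_on (ball 0 1) (alpha_poisson_kernel \<alpha>)"
  "continuous_on (ball 0 1) (kernel_dz \<alpha>)"
  "continuous_on (ball 0 1) (kernel_dzbar \<alpha>)"
proof -
  have nz: "1 - w \<noteq> 0" "1 - (cmod w)\<^sup>2 \<noteq> 0" "1 - w \<notin> \<real>\<^sub>\<le>\<^sub>0" if "w \<in> ball 0 1" for w :: complex
    using that one_minus_mult_norm_pos[of w 1] complex_Re_le_cmod[of w]
    by (auto simp: complex_nonpos_Reals_iff)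
  have powr: "continuous_on (ball 0 1) (\<lambda>w. (1 - w) powr b)" for b :: complex
    using nz(3) by (intro holomorphic_on_imp_continuous_on holomorphic_intros) blast
  show "continuous_on (ball 0 1) (alpha_poisson_kernel \<alpha>)"
    unfolding alpha_poisson_kernel_def[abs_def] by (intro continuous_intros powr) (use nz in auto)
  show "continuous_on (ball 0 1) (kernel_dz \<alpha>)"
    unfolding kernel_dz_def[abs_def] by (intro continuous_intros powr) (use nz in auto)
  show "continuous_on (ball 0 1) (kernel_dzbar \<alpha>)"
    unfolding kernel_dzbar_def[abs_def] by (intro continuous_intros powr) (use nz in auto)
qed

text \<open>The numerator of \<open>kernel_dz\<close> has modulus at most
  \<open>(1 + \<bar>\<alpha>\<bar>) * |1 - w|\<close>, since \<open>|1 - cnj w| = |1 - w|\<close>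
  and \<open>|w| < 1\<close>. One power of \<open>|1 - w|\<close> thus cancels, and both derivatives
  are compared with the same quotient \<open>X\<close>, with constants
  \<open>1 + \<bar>\<alpha>\<bar>\<close> and \<open>1 + \<alpha>\<close>.\<close>

lemma kernel_derivative_bound:
  assumes \<alpha>: "\<alpha> > -1" and w: "cmod w < 1"
  shows "cmod (kernel_dz \<alpha> w) + cmod (kernel_dzbar \<alpha> w) \<le>
    (if \<alpha> \<ge> 0 then 2 * (1 + \<alpha>) else 2) / (1 - (cmod w)\<^sup>2) *
    ((1 - (cmod w)\<^sup>2) powr (\<alpha> + 1) / cmod (1 - w) powr (\<alpha> + 2))"
proof -
  define d where "d = cmod (1 - w)"
  define K where "K = (if \<alpha> \<ge> 0 then 2 * (1 + \<alpha>) else 2)"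
  define X where "X = (1 - (cmod w)\<^sup>2) powr \<alpha> / d powr (\<alpha> + 2)"
  have pos: "0 < 1 - (cmod w)\<^sup>2"
    using one_minus_mult_norm_pos[of w 1] w by simp
  have d: "d > 0"
    using w by (auto simp: d_def)
  have d_cnj: "cmod (1 - cnj w) = d"
    unfolding d_def by (metis complex_cnj_diff complex_cnj_one complex_mod_cnj)
  have norm_powr: "cmod ((1 - w) powr (- of_real b)) = 1 / d powr b" for b
    unfolding d_def using norm_powr_real_powr'[of "- of_real b" "1 - w"] by (simp add: powr_minus_divide)
  have "cmod ((1 - cnj w) - of_real \<alpha> * cnj w * (1 - w)) \<le> d + \<bar>\<alpha>\<bar> * cmod w * d"
    by (rule norm_triangle_le_diff) (simp add: norm_mult d_cnj d_def)
  also have "\<dots> \<le> d + \<bar>\<alpha>\<bar> * 1 * d"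
    using w d by (intro add_left_mono mult_right_mono mult_left_mono) auto
  finally have "cmod ((1 - cnj w) - of_real \<alpha> * cnj w * (1 - w)) \<le> (1 + \<bar>\<alpha>\<bar>) * d"
    by (simp add: algebra_simps)
  then have "cmod (kernel_dz \<alpha> w) \<le>
      (1 - (cmod w)\<^sup>2) powr \<alpha> * (1 / d powr (\<alpha> + 1)) * ((1 + \<bar>\<alpha>\<bar>) * d) / d\<^sup>2"
    unfolding kernel_dz_def norm_mult norm_divide norm_power complex_mod_cnj norm_powr d_def[symmetric]
    by (intro divide_right_mono mult_mono) auto
  also have "\<dots> = (1 + \<bar>\<alpha>\<bar>) * X"
    using d by (simp add: X_def power2_eq_square powr_add field_simps)
  finally have "cmod (kernel_dz \<alpha> w) \<le> (1 + \<bar>\<alpha>\<bar>) * X" .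
  moreover have "cmod (kernel_dzbar \<alpha> w) = (\<alpha> + 1) * X"
    using \<alpha> unfolding kernel_dzbar_def norm_mult complex_mod_cnj norm_powr norm_of_real X_def
    by (simp add: abs_mult)
  ultimately have "cmod (kernel_dz \<alpha> w) + cmod (kernel_dzbar \<alpha> w) \<le> (1 + \<bar>\<alpha>\<bar> + (\<alpha> + 1)) * X"
    by (simp add: algebra_simps)
  also have "1 + \<bar>\<alpha>\<bar> + (\<alpha> + 1) = K"
    by (auto simp: K_def)
  also have "X = ((1 - (cmod w)\<^sup>2) powr (\<alpha> + 1) / d powr (\<alpha> + 2)) / (1 - (cmod w)\<^sup>2)"
    using pos by (simp add: X_def powr_add)
  finally show ?thesis
    unfolding K_def[symmetric] d_def[symmetric]
    by (simp only: times_divide_eq_left times_divide_eq_right divide_divide_eq_left ac_simps)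
qed

section \<open>The essential supremum of a continuous boundary function\<close>

text \<open>If a continuous function exceeded its essential supremum at one point, it would do so on
  a nonempty open set of parameters, which is not negligible.\<close>

lemma cmod_le_circle_sup_norm:
  assumes g: "continuous_on (sphere 0 1) g" and t: "t \<in> {0..2*pi}"
  shows "cmod (g (cis t)) \<le> circle_sup_norm g"
proof -
  define M where "M = lebesgue_on {0..2*pi}"
  define u where "u t = cmod (g (cis t))" for t
  have contu: "continuous_on {0..2*pi} u"
    unfolding u_def by (intro continuous_intros continuous_on_compose2[OF g]) (auto intro!: continuous_intros)
  then have meas: "u \<in> borel_measurable M"
    unfolding M_def by (intro continuous_imp_measurable_on_sets_lebesgue) auto
  define E where "E = esssup M (\<lambda>t. ereal (u t))"
  obtain B where B: "\<And>t. t \<in> {0..2*pi} \<Longrightarrow> u t \<le> B"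
    using compact_imp_bounded[OF compact_continuous_image[OF contu compact_Icc]]
    by (metis abs_le_D1 bounded_iff imageI real_norm_def)
  have le: "ereal (u s) \<le> E" if s: "s \<in> {0..2*pi}" for s
  proof (rule ccontr)
    assume "\<not> ereal (u s) \<le> E"
    then obtain c where c: "E < ereal c" "c < u s"
      using ereal_dense2[of E "ereal (u s)"] by (auto simp: not_le)
    have "AE t in M. ereal (u t) \<le> E"
      unfolding E_def by (rule esssup_AE)
    then have "AE t in M. \<not> c < u t"
      by eventually_elim (use c in \<open>auto simp: less_le_not_le dest: order_trans\<close>)
    then obtain N where N: "{t \<in> space M. \<not> \<not> c < u t} \<subseteq> N" "emeasure M N = 0" "N \<in> sets M"
      by (rule AE_E)
    then have "N \<in> null_sets M"
      by (simp add: null_setsI)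
    then have "negligible N"
      by (simp add: M_def null_sets_restrict_space negligible_iff_null_sets)
    then have null: "negligible {t \<in> {0..2*pi}. c < u t}"
      by (rule negligible_subset) (use N(1) in \<open>simp add: M_def\<close>)
    have "openin (top_of_set {0..2*pi}) ({0..2*pi} \<inter> u -` {c<..})"
      using contu by (rule continuous_openin_preimage_gen) auto
    then obtain T where T: "open T" "{0..2*pi} \<inter> u -` {c<..} = {0..2*pi} \<inter> T"
      unfolding openin_open by blast
    have "s \<in> {0..2*pi} \<inter> u -` {c<..}"
      using s c by simp
    then have "s \<in> T"
      unfolding T(2) by simp
    \<comment> \<open>The point \<open>s\<close> may be an endpoint of the parameter interval;
      passing through the closure still yields an open set inside it.\<close>
    moreover have "s \<in> closure {0<..<2*pi}"
      using s by simp
    ultimately have "T \<inter> {0<..<2*pi} \<noteq> {}"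
      using T(1) open_Int_closure_eq_empty by blast
    then have "\<not> negligible (T \<inter> {0<..<2*pi})"
      by (rule open_not_negligible[OF open_Int[OF T(1) open_greaterThanLessThan]])
    moreover have "T \<inter> {0<..<2*pi} \<subseteq> {t \<in> {0..2*pi}. c < u t}"
    proof
      fix x
      assume "x \<in> T \<inter> {0<..<2*pi}"
      then have "x \<in> {0..2*pi} \<inter> u -` {c<..}"
        unfolding T(2) by simp
      then show "x \<in> {t \<in> {0..2*pi}. c < u t}"
        by simp
    qed
    ultimately show False
      using null negligible_subset by blast
  qed
  have "E \<le> ereal B"
    unfolding E_def
  proof (rule esssup_I)
    show "(\<lambda>t. ereal (u t)) \<in> borel_measurable M"
      using meas by measurable
    show "AE t in M. ereal (u t) \<le> ereal B"
      using B by (intro AE_I2) (auto simp: M_def)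
  qed
  \<comment> \<open>Finiteness rules out the default value 0 that \<open>real_of_ereal\<close> takes
    at infinity.\<close>
  then have "\<bar>E\<bar> \<noteq> \<infinity>"
    using le[OF t] by auto
  then have "ereal (real_of_ereal E) = E"
    by (rule ereal_real')
  moreover have "circle_sup_norm g = real_of_ereal E"
    by (simp add: circle_sup_norm_def E_def M_def u_def)
  ultimately show ?thesis
    using le[OF t] by (metis ereal_less_eq(3) u_def)
qed

subsection \<open>The Poisson representation and the gradient estimate\<close>

text \<open>The geometric series rebuilds \<open>F\<close> from the nonnegative Fourier coefficients
  of \<open>g\<close>, as in Cauchy's formula; the potential is rebuilt from the negative ones with
  weights that undo the factor \<open>Beta (m + 1) (\<alpha> + 1)\<close>. The two resulting kernels
  add up to the closed form.\<close>

lemma alpha_harmonic_poisson_representation: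
  fixes f g :: "complex \<Rightarrow> complex"
  assumes \<alpha>: "\<alpha> > -1" and g: "continuous_on (sphere 0 1) g"
    and harm: "alpha_harmonic \<alpha> f" and bv: "distributional_boundary_value f g"
    and z: "cmod z < 1"
  shows "2 * pi * f z = integral {0..2*pi} (\<lambda>t. g (cis t) * alpha_poisson_kernel \<alpha> (z * cis (- t)))"
proof -
  obtain F H where FH: "F holomorphic_on ball 0 1" "H holomorphic_on ball 0 1"
    "\<And>z. z \<in> ball 0 1 \<Longrightarrow> f z = F z + dbar_potential \<alpha> H z"
    using alpha_harmonic_decomposition[OF harm] by blast
  define A where "A n = (deriv ^^ n) F 0 / fact n" for n
  define h where "h n = (deriv ^^ n) H 0 / fact n" for n
  have A: "(\<lambda>n. A n * w ^ n) sums F w" and h: "(\<lambda>n. h n * w ^ n) sums H w" if "cmod w < 1" for w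
    using holomorphic_power_series[OF FH(1), of w] holomorphic_power_series[OF FH(2), of w] that
    by (simp_all add: A_def h_def)
  have f: "f w = F w + dbar_potential \<alpha> H w" if "cmod w < 1" for w
    using FH(3) that by simp
  note coeffs = boundary_coefficients[OF \<alpha> A h f bv]
  have contg: "continuous_on {0..2*pi} (\<lambda>t. g (cis t))"
    by (intro continuous_on_compose2[OF g]) (auto intro!: continuous_intros)
  obtain B where B: "\<And>t. t \<in> {0..2*pi} \<Longrightarrow> cmod (g (cis t)) \<le> B"
    using compact_imp_bounded[OF compact_continuous_image[OF contg compact_Icc]]
    by (metis bounded_iff imageI)
  have norm_z: "cmod (z * cis (- t)) = cmod z" for t
    by (simp add: norm_mult)
  have rotate: "(z * cis (- t)) ^ n = z ^ n * cis (- (real n * t))"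
    "cnj (z * cis (- t)) ^ n = cnj z ^ n * cis (real n * t)" for n t
    by (simp_all add: power_mult_distrib Complex.DeMoivre cis_cnj)
  have pos_part: "(\<lambda>n. integral {0..2*pi} (\<lambda>t. g (cis t) * (z * cis (- t)) ^ n)) sums
      integral {0..2*pi} (\<lambda>t. g (cis t) * (1 / (1 - z * cis (- t))))"
  proof (rule sums_integral_weierstrass(1))
    show "continuous_on {0..2*pi} (\<lambda>t. g (cis t) * (z * cis (- t)) ^ n)" for n
      by (intro continuous_intros contg)
    show "cmod (g (cis t) * (z * cis (- t)) ^ n) \<le> B * cmod z ^ n" if "t \<in> {0..2*pi}" for n t
      unfolding norm_mult[of "g _"] norm_power norm_z using B[OF that] by (intro mult_right_mono) auto
    show "summable (\<lambda>n. B * cmod z ^ n)"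
      using z by (intro summable_mult summable_geometric) auto
    show "(\<lambda>n. g (cis t) * (z * cis (- t)) ^ n) sums (g (cis t) * (1 / (1 - z * cis (- t))))" for t
      using geometric_sums[of "z * cis (- t)"] z by (intro sums_mult) (simp add: norm_z)
  qed
  have "integral {0..2*pi} (\<lambda>t. g (cis t) * (z * cis (- t)) ^ n) = 2 * pi * (A n * z ^ n)" for n
  proof -
    have "(\<lambda>t. g (cis t) * (z * cis (- t)) ^ n) = (\<lambda>t. z ^ n * (g (cis t) * cis (- (real n * t))))"
      by (simp add: rotate mult_ac)
    then show ?thesis
      by (simp only: integral_mult_right coeffs(1)) (simp add: mult_ac)
  qed
  with pos_part have "(\<lambda>n. 2 * pi * (A n * z ^ n)) sums
      integral {0..2*pi} (\<lambda>t. g (cis t) * (1 / (1 - z * cis (- t))))"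
    by simp
  then have F_eq: "2 * pi * F z = integral {0..2*pi} (\<lambda>t. g (cis t) * (1 / (1 - z * cis (- t))))"
    by (rule sums_unique2[rotated]) (intro sums_mult A z)

  \<comment> \<open>\<open>\<kappa> m\<close> is \<open>1 / Beta (m + 1) (\<alpha> + 1)\<close>,
    \<open>K\<close> is its generating function, and \<open>p m\<close> is the term of order
    \<open>m\<close> in the series of the potential of \<open>K\<close>.\<close>
  define \<kappa> where "\<kappa> m = (\<alpha> + 1) * (pochhammer (\<alpha> + 2) m / fact m)" for m
  define K where "K w = of_real (\<alpha> + 1) * (1 - w) powr (- of_real (\<alpha> + 2))" for w :: complex
  define p where "p m w = cnj (complex_of_real (\<kappa> m)) * cnj w ^ Suc m * of_real (inc_beta \<alpha> m ((cmod w)\<^sup>2))" for m w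
  have K: "(\<lambda>m. of_real (\<kappa> m) * w ^ m) sums K w" if "cmod w < 1" for w
    using sums_mult[OF binomial_series_neg_powr[OF that, of "\<alpha> + 2"], of "of_real (\<alpha> + 1)"]
    by (simp add: \<kappa>_def K_def mult.assoc)
  have neg_part: "(\<lambda>m. integral {0..2*pi} (\<lambda>t. g (cis t) * p m (z * cis (- t)))) sums
      integral {0..2*pi} (\<lambda>t. g (cis t) * dbar_potential \<alpha> K (z * cis (- t)))"
  proof (rule sums_integral_weierstrass(1))
    show "continuous_on {0..2*pi} (\<lambda>t. g (cis t) * p m (z * cis (- t)))" for m
      unfolding p_def norm_z by (intro continuous_intros contg)
    show "cmod (g (cis t) * p m (z * cis (- t))) \<le> B * norm (p m z)" if "t \<in> {0..2*pi}" for m t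
    proof -
      have "cmod (p m (z * cis (- t))) = cmod (p m z)"
        by (simp only: p_def norm_mult norm_power complex_mod_cnj norm_z norm_cis mult_1_right)
      then show ?thesis
        using B[OF that] by (simp add: norm_mult mult_right_mono)
    qed
    show "summable (\<lambda>m. B * norm (p m z))"
      unfolding p_def
      by (intro summable_mult inc_beta_series_summable power_series_abs_summable[OF K] z)
    show "(\<lambda>m. g (cis t) * p m (z * cis (- t))) sums (g (cis t) * dbar_potential \<alpha> K (z * cis (- t)))" for t
      unfolding p_def by (intro sums_mult dbar_potential_sums K) (simp_all only: norm_z z)
  qed
  have "integral {0..2*pi} (\<lambda>t. g (cis t) * p m (z * cis (- t))) =
      2 * pi * (cnj (h m) * cnj z ^ Suc m * of_real (inc_beta \<alpha> m ((cmod z)\<^sup>2)))" for m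
  proof -
    have "Beta (real (Suc m)) (\<alpha> + 1) * \<kappa> m = 1"
    proof -
      have "\<kappa> m \<noteq> 0"
        using \<alpha> pochhammer_pos[of "\<alpha> + 2" m] by (simp add: \<kappa>_def)
      then show ?thesis
        using inverse_Beta_Suc[OF \<alpha>, of m] unfolding \<kappa>_def[symmetric] by (auto simp: divide_eq_eq mult.commute split: if_splits)
    qed
    then have Beta: "complex_of_real (Beta (real (Suc m)) (\<alpha> + 1)) * of_real (\<kappa> m) = 1"
      by (metis of_real_1 of_real_mult)
    have "(\<lambda>t. g (cis t) * p m (z * cis (- t))) = (\<lambda>t. of_real (\<kappa> m) * cnj z ^ Suc m *
        of_real (inc_beta \<alpha> m ((cmod z)\<^sup>2)) * (g (cis t) * cis (real (Suc m) * t)))"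
      unfolding p_def norm_z rotate complex_cnj_complex_of_real by (simp only: mult_ac)
    then have "integral {0..2*pi} (\<lambda>t. g (cis t) * p m (z * cis (- t))) =
        of_real (\<kappa> m) * cnj z ^ Suc m * of_real (inc_beta \<alpha> m ((cmod z)\<^sup>2)) *
        (2 * pi * (cnj (h m) * of_real (Beta (real (Suc m)) (\<alpha> + 1))))"
      by (simp only: integral_mult_right coeffs(2))
    also have "\<dots> = (of_real (Beta (real (Suc m)) (\<alpha> + 1)) * of_real (\<kappa> m)) *
        (2 * pi * (cnj (h m) * cnj z ^ Suc m * of_real (inc_beta \<alpha> m ((cmod z)\<^sup>2))))"
      by (simp only: mult_ac)
    finally show ?thesis
      unfolding Beta by simp
  qed
  with neg_part have "(\<lambda>m. 2 * pi * (cnj (h m) * cnj z ^ Suc m * of_real (inc_beta \<alpha> m ((cmod z)\<^sup>2)))) sums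
      integral {0..2*pi} (\<lambda>t. g (cis t) * dbar_potential \<alpha> K (z * cis (- t)))"
    by simp
  then have S_eq: "2 * pi * dbar_potential \<alpha> H z =
      integral {0..2*pi} (\<lambda>t. g (cis t) * dbar_potential \<alpha> K (z * cis (- t)))"
    by (rule sums_unique2[rotated]) (intro sums_mult dbar_potential_sums h z)

  have kernel: "alpha_poisson_kernel \<alpha> (z * cis (- t)) =
      1 / (1 - z * cis (- t)) + dbar_potential \<alpha> K (z * cis (- t))" for t
    unfolding K_def using alpha_poisson_kernel_eq[of "z * cis (- t)"] z by (simp add: norm_z)
  have in_ball: "z * cis (- t) \<in> ball 0 1" for t
    using z by (simp add: norm_mult)
  have nz: "1 - z * cis (- t) \<noteq> 0" for t
    using in_ball[of t] by auto
  have cont1: "continuous_on {0..2*pi} (\<lambda>t. g (cis t) * (1 / (1 - z * cis (- t))))"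
    by (intro continuous_intros contg) (use nz in auto)
  have cont2: "continuous_on {0..2*pi} (\<lambda>t. g (cis t) * alpha_poisson_kernel \<alpha> (z * cis (- t)))"
    by (intro continuous_on_mult contg continuous_on_compose2[OF continuous_on_kernels(1)] continuous_intros)
       (use in_ball in auto)
  \<comment> \<open>The potential is written as the difference of two explicit kernels, whose
    continuity justifies splitting the integral.\<close>
  have "integral {0..2*pi} (\<lambda>t. g (cis t) * dbar_potential \<alpha> K (z * cis (- t))) =
      integral {0..2*pi} (\<lambda>t. g (cis t) * alpha_poisson_kernel \<alpha> (z * cis (- t)) -
        g (cis t) * (1 / (1 - z * cis (- t))))"
    by (simp add: kernel algebra_simps)
  also have "\<dots> = integral {0..2*pi} (\<lambda>t. g (cis t) * alpha_poisson_kernel \<alpha> (z * cis (- t))) - 2 * pi * F z"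
    unfolding F_eq by (intro integral_diff integrable_continuous_real cont1 cont2)
  finally show ?thesis
    using f[OF z] S_eq by (simp add: algebra_simps)
qed

theorem corollary2p5:
  fixes \<alpha> :: real and f fstar :: "complex \<Rightarrow> complex"
  assumes "\<alpha> > -1"
    and "continuous_on (sphere 0 1) fstar"
    and "alpha_harmonic \<alpha> f"
    and "distributional_boundary_value f fstar"
  shows "\<forall>z\<in>ball 0 1. D_norm f z \<le>
    (if \<alpha> \<ge> 0
     then 2 * (1 + \<alpha>) / c_const \<alpha> * (circle_sup_norm fstar / (1 - (cmod z)\<^sup>2))
     else 2 / c_const \<alpha> * (circle_sup_norm fstar / (1 - (cmod z)\<^sup>2)))"
proof
  fix z :: complex
  assume z: "z \<in> ball 0 1"
  define M where "M = circle_sup_norm fstar"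
  define C where "C = (if \<alpha> \<ge> 0 then 2 * (1 + \<alpha>) else 2)"
  \<comment> \<open>The kernel depends on \<open>w * cis (- t)\<close>, so the chain rule multiplies
    its z derivative by \<open>cis (- t)\<close> and its z-bar derivative by the conjugate
    \<open>cis t\<close>; neither factor changes the modulus.\<close>
  define A where "A w t = fstar (cis t) * (kernel_dz \<alpha> (w * cis (- t)) * cis (- t))" for w t
  define B where "B w t = fstar (cis t) * (kernel_dzbar \<alpha> (w * cis (- t)) * cis t)" for w t
  define P where "P t = (1 - (cmod z)\<^sup>2) powr (\<alpha> + 1) / cmod (1 - z * cis (- t)) powr (\<alpha> + 2)" for t
  have in_ball: "w * cis (- t) \<in> ball 0 1" if "w \<in> ball 0 1" for w t
    using that by (simp add: norm_mult)
  have contg: "continuous_on {0..2*pi} (\<lambda>t. fstar (cis t))"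
    by (intro continuous_on_compose2[OF assms(2)]) (auto intro!: continuous_intros)
  have cont_kernel: "continuous_on (ball 0 1 \<times> {0..2*pi}) (\<lambda>(w, t). k (w * cis (- t)))"
    if "continuous_on (ball 0 1) k" for k :: "complex \<Rightarrow> complex"
    unfolding case_prod_unfold
    by (rule continuous_on_compose2[OF that]) (use in_ball in \<open>auto intro!: continuous_intros\<close>)
  have slice: "continuous_on {0..2*pi} (h w)"
    if "continuous_on (ball 0 1 \<times> {0..2*pi}) (\<lambda>(w, t). h w t)" "w \<in> ball 0 1"
    for h :: "complex \<Rightarrow> real \<Rightarrow> complex" and w
    using continuous_on_compose2[OF that(1) continuous_on_Pair[OF continuous_on_const[of "{0..2*pi}" w] continuous_on_id]] that(2)
    by (simp add: image_subset_iff)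
  have contg': "continuous_on (ball 0 1 \<times> {0..2*pi}) (\<lambda>x. fstar (cis (snd x)))" (is "continuous_on ?S _")
    by (rule continuous_on_compose2[OF contg continuous_on_snd]) (auto intro!: continuous_intros)
  have contA: "continuous_on ?S (\<lambda>(w, t). A w t)" and contB: "continuous_on ?S (\<lambda>(w, t). B w t)"
    unfolding A_def B_def case_prod_unfold
    by (intro continuous_intros contg' cont_kernel[unfolded case_prod_unfold] continuous_on_kernels)+
  have "((\<lambda>w. integral {0..2*pi} (\<lambda>t. fstar (cis t) * alpha_poisson_kernel \<alpha> (w * cis (- t)))) has_derivative
      (\<lambda>v. integral {0..2*pi} (A z) * v + integral {0..2*pi} (B z) * cnj v)) (at z)"
  proof (rule leibniz_rule_wirtinger[OF open_ball convex_ball z _ _ contA contB])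
    fix w :: complex
    assume w: "w \<in> ball 0 1"
    show "(\<lambda>t. fstar (cis t) * alpha_poisson_kernel \<alpha> (w * cis (- t))) integrable_on {0..2*pi}"
      by (intro integrable_continuous_real continuous_on_mult contg
          slice[of "\<lambda>w t. alpha_poisson_kernel \<alpha> (w * cis (- t))"] cont_kernel continuous_on_kernels w)
    show "((\<lambda>w. fstar (cis t) * alpha_poisson_kernel \<alpha> (w * cis (- t))) has_derivative
        (\<lambda>v. A w t * v + B w t * cnj v)) (at w)" for t
    proof -
      have "cmod (w * cis (- t)) < 1"
        using in_ball[OF w] by simp
      from has_derivative_compose[where f = "\<lambda>w. w * cis (- t)" and g = "alpha_poisson_kernel \<alpha>",
          OF has_derivative_mult_left[OF has_derivative_ident] has_derivative_alpha_poisson_kernel[OF this]]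
      have "((\<lambda>w. alpha_poisson_kernel \<alpha> (w * cis (- t))) has_derivative
          (\<lambda>v. kernel_dz \<alpha> (w * cis (- t)) * (v * cis (- t)) +
             kernel_dzbar \<alpha> (w * cis (- t)) * cnj (v * cis (- t)))) (at w)"
        by simp
      from has_derivative_mult_right[OF this, of "fstar (cis t)"] show ?thesis
        by (simp add: A_def B_def cis_cnj algebra_simps)
    qed
  qed
  from has_derivative_mult_right[OF this, of "1 / (2 * pi)"]
  have "((\<lambda>w. 1 / (2 * pi) * integral {0..2*pi} (\<lambda>t. fstar (cis t) * alpha_poisson_kernel \<alpha> (w * cis (- t)))) has_derivative
      (\<lambda>v. 1 / (2 * pi) * integral {0..2*pi} (A z) * v + 1 / (2 * pi) * integral {0..2*pi} (B z) * cnj v)) (at z)"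
    by (simp add: algebra_simps add_divide_distrib)
  moreover have "1 / (2 * pi) * integral {0..2*pi} (\<lambda>t. fstar (cis t) * alpha_poisson_kernel \<alpha> (w * cis (- t))) = f w"
    if "w \<in> ball 0 1" for w
    using alpha_harmonic_poisson_representation[OF assms, of w] that by (simp add: field_simps)
  ultimately have "(f has_derivative
      (\<lambda>v. 1 / (2 * pi) * integral {0..2*pi} (A z) * v + 1 / (2 * pi) * integral {0..2*pi} (B z) * cnj v)) (at z)"
    by (rule has_derivative_transform_within_open[OF _ open_ball z])
  note d = wirtinger_unique[OF this]
  have D: "2 * pi * D_norm f z = cmod (integral {0..2*pi} (A z)) + cmod (integral {0..2*pi} (B z))"
    unfolding D_norm_def d by (simp add: norm_mult norm_divide distrib_left)
  have intA: "A z integrable_on {0..2*pi}" and intB: "B z integrable_on {0..2*pi}"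
    and intA': "(\<lambda>t. cmod (A z t)) integrable_on {0..2*pi}" and intB': "(\<lambda>t. cmod (B z t)) integrable_on {0..2*pi}"
    using slice[OF contA z] slice[OF contB z] by (auto intro!: integrable_continuous_real continuous_intros)
  have pos: "0 < 1 - (cmod z)\<^sup>2"
    using one_minus_mult_norm_pos[of z 1] z by simp
  have M0: "0 \<le> M"
    unfolding M_def by (rule order_trans[OF norm_ge_zero cmod_le_circle_sup_norm[OF assms(2), of 0]]) simp
  have C0: "0 \<le> C"
    by (simp add: C_def)
  have nz: "1 - z * cis (- t) \<noteq> 0" for t
    using in_ball[OF z, of t] by auto
  have intP: "P integrable_on {0..2*pi}"
    unfolding P_def by (intro integrable_continuous_real continuous_intros) (use nz in auto)
  have bound: "cmod (A z t) + cmod (B z t) \<le> M * C / (1 - (cmod z)\<^sup>2) * P t" if t: "t \<in> {0..2*pi}" for t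
  proof -
    have "cmod (A z t) + cmod (B z t) =
        cmod (fstar (cis t)) * (cmod (kernel_dz \<alpha> (z * cis (- t))) + cmod (kernel_dzbar \<alpha> (z * cis (- t))))"
      by (simp add: A_def B_def norm_mult algebra_simps)
    also have "\<dots> \<le> M * (C / (1 - (cmod z)\<^sup>2) * P t)"
      using kernel_derivative_bound[OF assms(1), of "z * cis (- t)"] in_ball[OF z, of t]
        cmod_le_circle_sup_norm[OF assms(2) t] M0
      unfolding M_def[symmetric] C_def[symmetric] P_def
      by (intro mult_mono) (simp_all add: norm_mult)
    finally show ?thesis
      by (simp add: mult.assoc)
  qed
  \<comment> \<open>Each integral is estimated by the integral of its modulus, and the two are then
    merged, because the pointwise kernel bound controls the sum of the two derivatives.\<close>
  have "2 * pi * D_norm f z \<le>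
      integral {0..2*pi} (\<lambda>t. cmod (A z t)) + integral {0..2*pi} (\<lambda>t. cmod (B z t))"
    unfolding D by (intro add_mono integral_norm_bound_integral intA intB intA' intB') auto
  also have "\<dots> = integral {0..2*pi} (\<lambda>t. cmod (A z t) + cmod (B z t))"
    by (intro integral_add[symmetric] intA' intB')
  also have "\<dots> \<le> integral {0..2*pi} (\<lambda>t. M * C / (1 - (cmod z)\<^sup>2) * P t)"
    by (intro integral_le integrable_add integrable_on_mult_right intA' intB' intP bound)
  also have "\<dots> \<le> M * C / (1 - (cmod z)\<^sup>2) * (2 * pi / c_const \<alpha>)"
    unfolding integral_mult_right P_def
    using integral_norm_kernel_le[OF assms(1)] z pos M0 C0 by (intro mult_left_mono) auto
  also have "\<dots> = 2 * pi * (C / c_const \<alpha> * (M / (1 - (cmod z)\<^sup>2)))"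
    by (simp add: mult_ac)
  finally have "D_norm f z \<le> C / c_const \<alpha> * (M / (1 - (cmod z)\<^sup>2))"
    by (rule mult_left_le_imp_le) simp
  then show "D_norm f z \<le>
    (if \<alpha> \<ge> 0
     then 2 * (1 + \<alpha>) / c_const \<alpha> * (circle_sup_norm fstar / (1 - (cmod z)\<^sup>2))
     else 2 / c_const \<alpha> * (circle_sup_norm fstar / (1 - (cmod z)\<^sup>2)))"
    unfolding C_def M_def by (cases "\<alpha> \<ge> 0") simp_all
qed

end
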